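(* Let $\Gamma\subseteq\mathcal{T}$ be discrete countable LCA groups with $\mathcal{T}/\Gamma$ finite, let $(\mathcal{X},\mu)$ be a $\sigma$-finite measure space, and let $\sigma$ be a quasi-$\mathcal{T}$-invariant action of $\mathcal{T}$ on $\mathcal{X}$ with the tiling property, with tiling set $C_{\mathcal{T}}$; $\Gamma$ acts on $\mathcal{X}$ by restriction of $\sigma$. Let $\psi\in L^2(\mathcal{X})$. If $f\in S_\Gamma(\psi)$, then there exists a measurable $\Gamma^*$-periodic function $h$ defined on $\widehat{\mathcal{T}}$ such that $$Z_{\mathcal{T}}[f](\hat\tau)=h(\hat\tau)\,Z_{\mathcal{T}}[\psi](\hat\tau)\quad\text{for } m_{\widehat{\mathcal{T}}}\text{-a.e. }\hat\tau\in\widehat{\mathcal{T}}.$$ Moreover, if $f\in L^2(\mathcal{X})$ is such that $Z_{\mathcal{T}}[f](\hat\tau)=h(\hat\tau)Z_{\mathcal{T}}[\psi](\hat\tau)$ for $m_{\widehat{\mathcal{T}}}$-a.e. $\hat\tau\in\widehat{\mathcal{T}}$, for some measurable $\Gamma^*$-periodic function $h$ defined on $\widehat{\mathcal{T}}$, then $f\in S_\Gamma(\psi)$.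
   Context: Groups are written additively; $\widehat{G}$ is the Pontryagin dual of an LCA group $G$, $m_{\widehat G}$ its Haar measure, and $(x,\xi)$ denotes the character $\xi\in\widehat G$ evaluated at $x\in G$. $\Gamma^*=\{\xi\in\widehat{\mathcal{T}}:(\gamma,\xi)=1\ \forall\gamma\in\Gamma\}$ is the annihilator of $\Gamma$. A (complex-valued) function $h$ on $\widehat{\mathcal{T}}$ is $\Gamma^*$-periodic if $h(\hat\tau+\gamma^* )=h(\hat\tau)$ for all $\gamma^*\in\Gamma^*$. Actions. Let $G$ be a discrete countable LCA group. A measurable action $\sigma:G\times\mathcal{X}\to\mathcal{X}$, $\sigma_g(x)=\sigma(g,x)$, satisfies: each $\sigma_g$ is $\mu$-measurable, $\sigma_g\circ\sigma_{g'}=\sigma_{g+g'}$, and $\sigma_e=\mathrm{id}$. It is quasi-$G$-invariant if there is a measurable function $J_\sigma:G\times\mathcal{X}\to\mathbb{R}^+$ (the Jacobian) with $d\mu(\sigma_g(x))=J_\sigma(g,x)\,d\mu(x)$. It induces the unitary representation $\Pi$ of $G$ on $L^2(\mathcal{X})$, $\Pi_g f(x)=J_\sigma(-g,x)^{1/2}f(\sigma_{-g}(x))$. It has the tiling property if there is a measurable set $C_G\subseteq\mathcal{X}$ (a tiling set) with $\mu(\mathcal{X}\setminus\bigcup_{g\in G}\sigma_g(C_G))=0$ and $\mu(\sigma_g(C_G)\cap\sigma_{g'}(C_G))=0$ for $g\ne g'$. $S_\Gamma(\psi)=\overline{\mathrm{span}}\{\Pi_\gamma\psi:\gamma\in\Gamma\}\subseteq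 L^2(\mathcal{X})$. Zak transform. $Z_{\mathcal{T}}:L^2(\mathcal{X})\to L^2(\widehat{\mathcal{T}},L^2(C_{\mathcal{T}}))$ is the isometric isomorphism (Haar measure on $\widehat{\mathcal{T}}$ suitably normalized) given by $$Z_{\mathcal{T}}[f](\hat\tau)(x)=\sum_{\tau\in\mathcal{T}}\Pi_\tau f(x)\,(-\tau,\hat\tau),\qquad \hat\tau\in\widehat{\mathcal{T}},\ x\in C_{\mathcal{T}}.$$ *)

theory Defs
  imports "HOL-Analysis.Analysis"
begin

section \<open>Square-integrable functions\<close>

text \<open>Elements of \<open>L\<^sup>2\<close> are represented by functions; two functions denote the same element
  iff they agree almost everywhere.\<close>

definition L2 :: "'x measure \<Rightarrow> ('x \<Rightarrow> complex) set"
  where "L2 M = {f \<in> borel_measurable M. integrable M (\<lambda>x. (cmod (f x))\<^sup>2)}"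

definition L2_norm :: "'x measure \<Rightarrow> ('x \<Rightarrow> complex) \<Rightarrow> real"
  where "L2_norm M f = sqrt (\<integral>x. (cmod (f x))\<^sup>2 \<partial>M)"

definition L2_closed_span :: "'x measure \<Rightarrow> ('x \<Rightarrow> complex) set \<Rightarrow> ('x \<Rightarrow> complex) set"
  where "L2_closed_span M A = {f \<in> L2 M. \<forall>\<epsilon>>0. \<exists>F c. finite F \<and> F \<subseteq> A \<and>
           L2_norm M (\<lambda>x. f x - (\<Sum>g\<in>F. c g * g x)) < \<epsilon>}"

text \<open>The space \<open>L\<^sup>2(m, L\<^sup>2(N))\<close> of \<open>L\<^sup>2(N)\<close>-valued functions. For sigma-finite \<open>m\<close> and \<open>N\<close>
  every (strongly measurable) element has a jointly measurable representative, and
  conversely, which is how measurability is expressed here.\<close>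

definition L2_L2 :: "'a measure \<Rightarrow> 'x measure \<Rightarrow> ('a \<Rightarrow> 'x \<Rightarrow> complex) set"
  where "L2_L2 m N = {F. case_prod F \<in> borel_measurable (m \<Otimes>\<^sub>M N) \<and>
           (AE \<xi> in m. F \<xi> \<in> L2 N) \<and> integrable m (\<lambda>\<xi>. (L2_norm N (F \<xi>))\<^sup>2)}"

definition L2_L2_norm :: "'a measure \<Rightarrow> 'x measure \<Rightarrow> ('a \<Rightarrow> 'x \<Rightarrow> complex) \<Rightarrow> real"
  where "L2_L2_norm m N F = sqrt (\<integral>\<xi>. (L2_norm N (F \<xi>))\<^sup>2 \<partial>m)"


section \<open>Groups and duals\<close>

text \<open>Discrete countable abelian groups are types of class \<open>{ab_group_add, countable}\<close>.\<close>

definition add_subgroup :: "'g::ab_group_add set \<Rightarrow> bool"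
  where "add_subgroup \<Gamma> \<longleftrightarrow> 0 \<in> \<Gamma> \<and> (\<forall>a\<in>\<Gamma>. \<forall>b\<in>\<Gamma>. a + b \<in> \<Gamma>) \<and> (\<forall>a\<in>\<Gamma>. - a \<in> \<Gamma>)"

definition cosets :: "'g::ab_group_add set \<Rightarrow> 'g set set"
  where "cosets \<Gamma> = UNIV // {(s, t). s - t \<in> \<Gamma>}"

definition dual_group :: "('g::ab_group_add \<Rightarrow> complex) set"
  where "dual_group = {\<xi>. (\<forall>s t. \<xi> (s + t) = \<xi> s * \<xi> t) \<and> (\<forall>t. cmod (\<xi> t) = 1)}"

text \<open>The group operation of the dual, written additively in the mathematical notation.\<close>

definition dual_add :: "('g \<Rightarrow> complex) \<Rightarrow> ('g \<Rightarrow> complex) \<Rightarrow> ('g \<Rightarrow> complex)"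
  where "dual_add \<xi> \<eta> = (\<lambda>t. \<xi> t * \<eta> t)"

definition annihilator :: "'g::ab_group_add set \<Rightarrow> ('g \<Rightarrow> complex) set"
  where "annihilator \<Gamma> = {\<xi> \<in> dual_group. \<forall>\<gamma>\<in>\<Gamma>. \<xi> \<gamma> = 1}"

text \<open>The group being discrete, the topology of its dual is that of pointwise convergence, i.e.
  the subspace topology inherited from the product topology on \<open>'g \<Rightarrow> complex\<close>. The dual is
  compact and metrizable, so Haar measure is a finite Borel measure (automatically regular);
  it is normalized to total mass 1, which makes the Zak transform isometric.\<close>

definition dual_haar :: "('g::{ab_group_add, countable} \<Rightarrow> complex) measure \<Rightarrow> bool"
  where "dual_haar m \<longleftrightarrow>
     space m = dual_group \<and> sets m = sets (restrict_space borel dual_group) \<and> emeasure m (space m) = 1 \<and>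
     (\<forall>\<eta>\<in>dual_group. \<forall>A\<in>sets m. emeasure m (dual_add \<eta> ` A) = emeasure m A)"

definition dual_periodic ::
    "'g::ab_group_add set \<Rightarrow> (('g \<Rightarrow> complex) \<Rightarrow> complex) \<Rightarrow> bool"
  where "dual_periodic \<Gamma> h \<longleftrightarrow>
     (\<forall>\<xi>\<in>dual_group. \<forall>\<eta>\<in>annihilator \<Gamma>. h (dual_add \<xi> \<eta>) = h \<xi>)"


section \<open>Quasi-invariant actions and the Zak transform\<close>

definition measurable_action ::
    "'x measure \<Rightarrow> ('g::ab_group_add \<Rightarrow> 'x \<Rightarrow> 'x) \<Rightarrow> bool"
  where "measurable_action M \<sigma> \<longleftrightarrow>
     (\<forall>g. \<sigma> g \<in> measurable M M) \<and>
     (\<forall>g g'. \<forall>x\<in>space M. \<sigma> g (\<sigma> g' x) = \<sigma> (g + g') x) \<and>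
     (\<forall>x\<in>space M. \<sigma> 0 x = x)"

text \<open>The last clause is the relation \<open>d\<mu>(\<sigma>\<^sub>g(x)) = J(g,x) d\<mu>(x)\<close>. Images of measurable
  sets under \<open>\<sigma> g\<close> are measurable because \<open>\<sigma> (- g)\<close> inverts \<open>\<sigma> g\<close> on \<open>space M\<close>.\<close>

definition quasi_invariant_action ::
    "'x measure \<Rightarrow> ('g::{ab_group_add, countable} \<Rightarrow> 'x \<Rightarrow> 'x) \<Rightarrow> ('g \<Rightarrow> 'x \<Rightarrow> real) \<Rightarrow> bool"
  where "quasi_invariant_action M \<sigma> J \<longleftrightarrow>
     measurable_action M \<sigma> \<and>
     case_prod J \<in> borel_measurable (count_space UNIV \<Otimes>\<^sub>M M) \<and>
     (\<forall>g. \<forall>x\<in>space M. 0 < J g x) \<and>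
     (\<forall>g. \<forall>A\<in>sets M. emeasure M (\<sigma> g ` A) = (\<integral>\<^sup>+x\<in>A. ennreal (J g x) \<partial>M))"

definition tiling_set ::
    "'x measure \<Rightarrow> ('g::{ab_group_add, countable} \<Rightarrow> 'x \<Rightarrow> 'x) \<Rightarrow> 'x set \<Rightarrow> bool"
  where "tiling_set M \<sigma> C \<longleftrightarrow>
     C \<in> sets M \<and>
     space M - (\<Union>g. \<sigma> g ` C) \<in> null_sets M \<and>
     (\<forall>g g'. g \<noteq> g' \<longrightarrow> \<sigma> g ` C \<inter> \<sigma> g' ` C \<in> null_sets M)"

definition action_rep ::
    "('g::ab_group_add \<Rightarrow> 'x \<Rightarrow> 'x) \<Rightarrow> ('g \<Rightarrow> 'x \<Rightarrow> real) \<Rightarrow> 'g \<Rightarrow> ('x \<Rightarrow> complex) \<Rightarrow> 'x \<Rightarrow> complex"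
  where "action_rep \<sigma> J g f = (\<lambda>x. complex_of_real (sqrt (J (- g) x)) * f (\<sigma> (- g) x))"

definition invariant_span ::
    "'x measure \<Rightarrow> ('g::ab_group_add \<Rightarrow> 'x \<Rightarrow> 'x) \<Rightarrow> ('g \<Rightarrow> 'x \<Rightarrow> real) \<Rightarrow> 'g set \<Rightarrow>
     ('x \<Rightarrow> complex) \<Rightarrow> ('x \<Rightarrow> complex) set"
  where "invariant_span M \<sigma> J \<Gamma> \<psi> =
     L2_closed_span M ((\<lambda>\<gamma>. action_rep \<sigma> J \<gamma> \<psi>) ` \<Gamma>)"

text \<open>For general \<open>f\<close> in \<open>L\<^sup>2\<close> the series defining the Zak transform need not converge pointwise;
  it converges unconditionally in \<open>L\<^sup>2(m, L\<^sup>2(C))\<close>. Its sum is determined up to null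
  sets, and \<open>zak\<close> picks a representative.\<close>

definition has_zak ::
    "'x measure \<Rightarrow> ('g::ab_group_add \<Rightarrow> 'x \<Rightarrow> 'x) \<Rightarrow> ('g \<Rightarrow> 'x \<Rightarrow> real) \<Rightarrow> 'x set \<Rightarrow>
     ('g \<Rightarrow> complex) measure \<Rightarrow> ('x \<Rightarrow> complex) \<Rightarrow> (('g \<Rightarrow> complex) \<Rightarrow> 'x \<Rightarrow> complex) \<Rightarrow> bool"
  where "has_zak M \<sigma> J C m f F \<longleftrightarrow>
     F \<in> L2_L2 m (restrict_space M C) \<and>
     ((\<lambda>A. L2_L2_norm m (restrict_space M C)
             (\<lambda>\<xi> x. F \<xi> x - (\<Sum>\<tau>\<in>A. action_rep \<sigma> J \<tau> f x * \<xi> (- \<tau>))))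
        \<longlongrightarrow> 0) (finite_subsets_at_top UNIV)"

definition zak ::
    "'x measure \<Rightarrow> ('g::ab_group_add \<Rightarrow> 'x \<Rightarrow> 'x) \<Rightarrow> ('g \<Rightarrow> 'x \<Rightarrow> real) \<Rightarrow> 'x set \<Rightarrow>
     ('g \<Rightarrow> complex) measure \<Rightarrow> ('x \<Rightarrow> complex) \<Rightarrow> ('g \<Rightarrow> complex) \<Rightarrow> 'x \<Rightarrow> complex"
  where "zak M \<sigma> J C m f = (SOME F. has_zak M \<sigma> J C m f F)"

end

theory Submission imports Defs begin

text \<open>The Zak transform is an isometry that turns \<open>\<Pi>\<^sub>\<gamma>\<close> into multiplication by \<open>\<xi> \<mapsto> \<xi> \<gamma>\<close>, so the
  span of the \<open>\<Pi>\<^sub>\<gamma> \<psi>\<close> corresponds to the products \<open>p Z\<psi>\<close> with \<open>p\<close> a trigonometric polynomial with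
  frequencies in \<open>\<Gamma>\<close>, and such \<open>p\<close> are \<open>\<Gamma>\<^sup>*\<close>-periodic. If \<open>p\<^sub>n Z\<psi> \<rightarrow> Zf\<close> in \<open>L\<^sup>2\<close>, a subsequence
  converges almost everywhere, hence \<open>p\<^sub>n\<close> converges almost everywhere on the set where \<open>Z\<psi> \<xi>\<close> is not
  the zero class, and its limit is \<open>h\<close>. Conversely, if \<open>Zf = h Z\<psi>\<close>, then \<open>h\<close> lies in \<open>L\<^sup>2\<close> for the
  weight \<open>\<parallel>Z\<psi> \<xi>\<parallel>\<^sup>2\<close>. Since \<open>\<Gamma>\<^sup>*\<close> is finite, \<open>h\<close> is also in \<open>L\<^sup>2\<close> for the \<open>\<Gamma>\<^sup>*\<close>-symmetrised weight, where it
  is a limit of trigonometric polynomials by Stone-Weierstrass; averaging these over \<open>\<Gamma>\<^sup>*\<close> kills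
  exactly the frequencies outside \<open>\<Gamma>\<close>.\<close>

section \<open>Completeness of square-integrable functions\<close>

text \<open>Three obstacles shape the proof. \<open>zak\<close> is a choice among unconditional L2
  limits, so it says nothing until such a limit is shown to exist; this calls for completeness of
  L2, and the vector-valued space is identified with scalar L2 of the product measure so that one
  completeness theorem suffices. Parseval on the dual and the removal of frequencies outside
  \<Gamma> both need characters that are nontrivial at a given element; one extension argument,
  applied to the subgroups {0} and \<Gamma>, supplies them. Finally, \<open>h\<close> need not be
  square-integrable for Haar measure, only its product with the norm of Z\<psi> is; density of
  polynomials is therefore proved for every finite Borel measure on the dual. The weight has to be
  symmetrised because averaging evaluates a polynomial at translated points, where its error is
  controlled only by translates of the weight.\<close>

definition L2_sq :: "'x measure \<Rightarrow> ('x \<Rightarrow> complex) \<Rightarrow> ennreal"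
  where "L2_sq M f = (\<integral>\<^sup>+x. ennreal ((cmod (f x))\<^sup>2) \<partial>M)"

text \<open>The Bochner integral inside \<open>L2_norm\<close> is 0 for a non-integrable function,
  so a small \<open>L2_norm\<close> alone does not show membership in \<open>L2\<close>. The
  extended-real \<open>L2_sq\<close> does, and it can be estimated before integrability is
  known.\<close>

lemma L2_iff: "f \<in> L2 M \<longleftrightarrow> f \<in> borel_measurable M \<and> L2_sq M f < \<infinity>"
  unfolding L2_def L2_sq_def
  by (auto simp: integrable_iff_bounded)

lemma L2_measurable [measurable_dest]: "f \<in> L2 M \<Longrightarrow> f \<in> borel_measurable M"
  by (simp add: L2_def)

lemma L2_norm_nonneg [simp]: "0 \<le> L2_norm M f"
  by (simp add: L2_norm_def)

lemma L2_norm_sq: "(L2_norm M f)\<^sup>2 = (\<integral>x. (cmod (f x))\<^sup>2 \<partial>M)"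
  by (simp add: L2_norm_def)

lemma L2_sq_eq: "f \<in> L2 M \<Longrightarrow> L2_sq M f = ennreal ((L2_norm M f)\<^sup>2)"
  unfolding L2_norm_sq L2_sq_def by (rule nn_integral_eq_integral) (auto simp: L2_def)

lemma L2_sq_le_iff:
  assumes "f \<in> L2 M" "0 \<le> r"
  shows "L2_norm M f \<le> r \<longleftrightarrow> L2_sq M f \<le> ennreal (r\<^sup>2)"
  using assms by (simp add: L2_sq_eq abs_le_square_iff[symmetric])

lemma L2_norm_le:
  assumes "f \<in> L2 M" "0 \<le> r" "L2_sq M f \<le> ennreal (r\<^sup>2)"
  shows "L2_norm M f \<le> r"
  using assms L2_sq_le_iff by blast

lemma L2_sq_cong_AE: "(AE x in M. f x = g x) \<Longrightarrow> L2_sq M f = L2_sq M g"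
  unfolding L2_sq_def by (rule nn_integral_cong_AE) auto

lemma L2_cong_AE:
  assumes "f \<in> L2 M" "g \<in> borel_measurable M" "AE x in M. f x = g x"
  shows "g \<in> L2 M"
  using assms L2_sq_cong_AE[of f g M] by (simp add: L2_iff)

text \<open>Young's inequality with a free parameter: the slack is the square (s|a| - |b|)^2 / s.
  Optimising s later replaces Cauchy-Schwarz in the triangle inequality.\<close>

lemma norm_add_sq_le:
  fixes a b :: complex
  assumes s: "0 < s"
  shows "(cmod (a + b))\<^sup>2 \<le> (1 + s) * (cmod a)\<^sup>2 + (1 + 1 / s) * (cmod b)\<^sup>2"
proof -
  have "(cmod (a + b))\<^sup>2 \<le> (cmod a + cmod b)\<^sup>2"
    by (simp add: norm_triangle_ineq power_mono)
  also have "\<dots> \<le> (cmod a + cmod b)\<^sup>2 + (s * cmod a - cmod b)\<^sup>2 / s"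
    using s by simp
  also have "\<dots> = (1 + s) * (cmod a)\<^sup>2 + (1 + 1 / s) * (cmod b)\<^sup>2"
    using s by (simp add: power2_eq_square field_simps)
  finally show ?thesis .
qed

lemma L2_sq_add_le:
  assumes [measurable]: "f \<in> borel_measurable M" "g \<in> borel_measurable M" and s: "0 < s"
  shows "L2_sq M (\<lambda>x. f x + g x) \<le> ennreal (1 + s) * L2_sq M f + ennreal (1 + 1 / s) * L2_sq M g"
proof -
  have "L2_sq M (\<lambda>x. f x + g x)
      \<le> (\<integral>\<^sup>+x. ennreal (1 + s) * ennreal ((cmod (f x))\<^sup>2) + ennreal (1 + 1 / s) * ennreal ((cmod (g x))\<^sup>2) \<partial>M)"
    unfolding L2_sq_def
    using s norm_add_sq_le[OF s]
    by (intro nn_integral_mono) (simp add: ennreal_mult[symmetric] ennreal_plus[symmetric] del: ennreal_plus)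
  also have "\<dots> = ennreal (1 + s) * L2_sq M f + ennreal (1 + 1 / s) * L2_sq M g"
    unfolding L2_sq_def by (simp add: nn_integral_add nn_integral_cmult)
  finally show ?thesis .
qed

lemma L2_add:
  assumes "f \<in> L2 M" "g \<in> L2 M"
  shows "(\<lambda>x. f x + g x) \<in> L2 M"
proof -
  have "L2_sq M (\<lambda>x. f x + g x) \<le> ennreal (1 + 1) * L2_sq M f + ennreal (1 + 1 / 1) * L2_sq M g"
    using assms by (intro L2_sq_add_le) (auto simp: L2_iff)
  also have "\<dots> < \<infinity>"
    using assms by (simp add: L2_iff ennreal_mult_less_top)
  finally show ?thesis
    using assms by (auto simp: L2_iff)
qed

lemma L2_sq_scale:
  assumes [measurable]: "f \<in> borel_measurable M"
  shows "L2_sq M (\<lambda>x. c * f x) = ennreal ((cmod c)\<^sup>2) * L2_sq M f"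
  unfolding L2_sq_def
  by (subst nn_integral_cmult[symmetric]) (auto simp: norm_mult power_mult_distrib ennreal_mult)

lemma L2_scale: "f \<in> L2 M \<Longrightarrow> (\<lambda>x. c * f x) \<in> L2 M"
  by (auto simp: L2_iff L2_sq_scale ennreal_mult_less_top)

lemma L2_diff: "f \<in> L2 M \<Longrightarrow> g \<in> L2 M \<Longrightarrow> (\<lambda>x. f x - g x) \<in> L2 M"
  using L2_add[of f M "\<lambda>x. - 1 * g x"] L2_scale[of g M "- 1"] by simp

lemma L2_zero: "(\<lambda>x. 0) \<in> L2 M"
  by (simp add: L2_def)

lemma L2_norm_scale: "L2_norm M (\<lambda>x. c * f x) = cmod c * L2_norm M f"
  by (simp add: L2_norm_def norm_mult power_mult_distrib real_sqrt_mult)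

lemma L2_norm_minus_commute: "L2_norm M (\<lambda>x. f x - g x) = L2_norm M (\<lambda>x. g x - f x)"
  by (simp add: L2_norm_def norm_minus_commute)

lemma L2_norm_triangle:
  assumes f: "f \<in> L2 M" and g: "g \<in> L2 M"
  shows "L2_norm M (\<lambda>x. f x + g x) \<le> L2_norm M f + L2_norm M g"
proof -
  let ?a = "L2_norm M f" and ?b = "L2_norm M g"
  have le: "(L2_norm M (\<lambda>x. f x + g x))\<^sup>2 \<le> (1 + s) * ?a\<^sup>2 + (1 + 1 / s) * ?b\<^sup>2" if s: "0 < s" for s
  proof -
    have "ennreal ((L2_norm M (\<lambda>x. f x + g x))\<^sup>2) \<le> ennreal (1 + s) * L2_sq M f + ennreal (1 + 1 / s) * L2_sq M g"
      using L2_sq_add_le[OF L2_measurable[OF f] L2_measurable[OF g] s] by (simp add: L2_sq_eq[symmetric] L2_add f g)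
    also have "\<dots> = ennreal ((1 + s) * ?a\<^sup>2 + (1 + 1 / s) * ?b\<^sup>2)"
      using s by (simp add: L2_sq_eq f g ennreal_mult ennreal_plus[of "(1 + s) * ?a\<^sup>2"] del: ennreal_plus)
    finally show ?thesis
      using s by (subst (asm) ennreal_le_iff) auto
  qed
  have "L2_norm M (\<lambda>x. f x + g x) \<le> ?a + ?b + e" if e: "0 < e" for e :: real
  proof -
    \<comment> \<open>Adding e / 2 makes both bounds positive, so that s = b / a is defined; this s
      minimises (1 + s) a^2 + (1 + 1/s) b^2, and the minimum is (a + b)^2.\<close>
    define a b where "a = ?a + e / 2" and "b = ?b + e / 2"
    have ab: "0 < a" "0 < b" "?a \<le> a" "?b \<le> b"
      using e L2_norm_nonneg[of M f] L2_norm_nonneg[of M g] by (auto simp: a_def b_def intro: add_nonneg_pos)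
    have "(L2_norm M (\<lambda>x. f x + g x))\<^sup>2 \<le> (1 + b / a) * ?a\<^sup>2 + (1 + 1 / (b / a)) * ?b\<^sup>2"
      by (rule le) (use ab in simp)
    also have "\<dots> \<le> (1 + b / a) * a\<^sup>2 + (1 + 1 / (b / a)) * b\<^sup>2"
      using ab by (intro add_mono mult_left_mono power_mono) auto
    also have "\<dots> = (a + b)\<^sup>2"
      using ab by (simp add: field_simps power2_eq_square)
    finally have "L2_norm M (\<lambda>x. f x + g x) \<le> a + b"
      by (rule power2_le_imp_le) (use ab in simp)
    then show ?thesis by (simp add: a_def b_def)
  qed
  then show ?thesis by (rule field_le_epsilon)
qed

lemma L2_norm_diff_triangle:
  assumes f: "f \<in> L2 M" and g: "g \<in> L2 M" and h: "h \<in> L2 M"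
  shows "L2_norm M (\<lambda>x. f x - h x) \<le> L2_norm M (\<lambda>x. f x - g x) + L2_norm M (\<lambda>x. g x - h x)"
  using L2_norm_triangle[OF L2_diff[OF f g] L2_diff[OF g h]] by simp

lemma L2_norm_triangle_diff:
  assumes f: "f \<in> L2 M" and g: "g \<in> L2 M"
  shows "\<bar>L2_norm M f - L2_norm M g\<bar> \<le> L2_norm M (\<lambda>x. f x - g x)"
  using L2_norm_triangle[OF L2_diff[OF f g] g] L2_norm_triangle[OF L2_diff[OF g f] f]
    L2_norm_minus_commute[of M f g] by simp

text \<open>The squared moduli tend to 0 in L1, which already yields an almost everywhere convergent
  subsequence.\<close>

lemma L2_AE_subseq:
  assumes u: "\<And>n. u n \<in> L2 M" and lim: "(\<lambda>n. L2_norm M (u n)) \<longlonglongrightarrow> 0"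
  shows "\<exists>r::nat\<Rightarrow>nat. strict_mono r \<and> (AE x in M. (\<lambda>n. u (r n) x) \<longlonglongrightarrow> 0)"
proof -
  have "(\<lambda>n. (L2_norm M (u n))\<^sup>2) \<longlonglongrightarrow> 0"
    using tendsto_power[OF lim, of 2] by simp
  then have "\<exists>r::nat\<Rightarrow>nat. strict_mono r \<and> (AE x in M. (\<lambda>n. (cmod (u (r n) x))\<^sup>2) \<longlonglongrightarrow> 0)"
    using u by (intro tendsto_L1_AE_subseq[of M "\<lambda>n x. (cmod (u n x))\<^sup>2"]) (auto simp: L2_def L2_norm_sq)
  moreover have "v \<longlonglongrightarrow> 0" if "(\<lambda>n. (cmod (v n))\<^sup>2) \<longlonglongrightarrow> 0" for v :: "nat \<Rightarrow> complex"
    using tendsto_real_sqrt[OF that] by (simp add: tendsto_norm_zero_iff)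
  ultimately show ?thesis by fast
qed

text \<open>A geometric rate gives pointwise convergence through a weighted sum of squares, and
  Fatou's lemma passes the rate on to the limit. The partial sums of the Zak series are later
  selected to meet this rate.\<close>

lemma L2_complete:
  fixes S :: "nat \<Rightarrow> 'x \<Rightarrow> complex"
  assumes S: "\<And>n. S n \<in> L2 M"
    and fast: "\<And>n. L2_norm M (\<lambda>x. S (Suc n) x - S n x) \<le> (1 / 2) ^ n"
  shows "\<exists>F \<in> L2 M. \<forall>n. L2_norm M (\<lambda>x. F x - S n x) \<le> 2 * (1 / 2) ^ n"
proof -
  note [measurable] = L2_measurable[OF S]
  define d where "d n x = S (Suc n) x - S n x" for n x
  have [measurable]: "d n \<in> borel_measurable M" for n
    unfolding d_def by measurable
  have dL2: "d n \<in> L2 M" for n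
    unfolding d_def by (rule L2_diff[OF S S])
  have dn: "L2_norm M (d n) \<le> (1 / 2) ^ n" for n
    using fast[of n] by (simp add: d_def[abs_def])
  have dsq: "L2_sq M (d n) \<le> ennreal ((1 / 4) ^ n)" for n
  proof -
    have "L2_sq M (d n) \<le> ennreal (((1 / 2) ^ n)\<^sup>2)"
      using dn[of n] L2_sq_le_iff[OF dL2[of n], of "(1 / 2) ^ n"] by simp
    also have "((1 / 2) ^ n)\<^sup>2 = (1 / 4 :: real) ^ n"
      by (simp add: power_mult_distrib[symmetric] power2_eq_square)
    finally show ?thesis .
  qed
  \<comment> \<open>The weight 2^n leaves a summable bound, since 2^n * 4^(-n) = 2^(-n). Where the
    weighted sum is finite, |d n x| is at most a constant times 2^(-n/2), so the telescoping series
    converges absolutely.\<close>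
  have "(\<integral>\<^sup>+x. (\<Sum>n. ennreal (2 ^ n * (cmod (d n x))\<^sup>2)) \<partial>M)
      = (\<Sum>n. \<integral>\<^sup>+x. ennreal (2 ^ n * (cmod (d n x))\<^sup>2) \<partial>M)"
    by (rule nn_integral_suminf) simp
  also have "\<dots> = (\<Sum>n. ennreal (2 ^ n) * L2_sq M (d n))"
    unfolding L2_sq_def by (subst nn_integral_cmult[symmetric]) (auto simp: ennreal_mult)
  also have "\<dots> \<le> (\<Sum>n. ennreal ((1 / 2) ^ n))"
  proof (intro suminf_le summableI)
    fix n
    have "ennreal (2 ^ n) * L2_sq M (d n) \<le> ennreal (2 ^ n) * ennreal ((1 / 4) ^ n)"
      by (intro mult_left_mono dsq) simp
    also have "\<dots> = ennreal ((1 / 2) ^ n)"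
      by (simp add: ennreal_mult[symmetric] power_mult_distrib[symmetric])
    finally show "ennreal (2 ^ n) * L2_sq M (d n) \<le> ennreal ((1 / 2) ^ n)" .
  qed
  also have "\<dots> = ennreal (\<Sum>n. (1 / 2) ^ n)"
    by (rule suminf_ennreal2) (auto intro: summable_geometric)
  also have "\<dots> < \<infinity>" by simp
  finally have "AE x in M. (\<Sum>n. ennreal (2 ^ n * (cmod (d n x))\<^sup>2)) \<noteq> \<infinity>"
    by (intro nn_integral_PInf_AE) (auto simp: less_top)
  then have conv: "AE x in M. convergent (\<lambda>n. S n x)"
  proof (rule AE_mp, intro AE_I2 impI)
    fix x assume fin: "(\<Sum>n. ennreal (2 ^ n * (cmod (d n x))\<^sup>2)) \<noteq> \<infinity>"
    have "summable (\<lambda>n. 2 ^ n * (cmod (d n x))\<^sup>2)"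
      by (rule summable_suminf_not_top) (use fin in auto)
    then have "(\<lambda>n. 2 ^ n * (cmod (d n x))\<^sup>2) \<longlonglongrightarrow> 0"
      by (rule summable_LIMSEQ_zero)
    then have "Bseq (\<lambda>n. 2 ^ n * (cmod (d n x))\<^sup>2)"
      by (intro convergent_imp_Bseq convergentI)
    then obtain K where K: "\<And>n. norm (2 ^ n * (cmod (d n x))\<^sup>2) \<le> K"
      unfolding Bseq_def by blast
    have "summable (\<lambda>n. d n x)"
    proof (rule summable_comparison_test')
      show "summable (\<lambda>n. sqrt K * (sqrt (1 / 2)) ^ n)"
        by (intro summable_mult summable_geometric) simp
      fix n :: nat
      have "(cmod (d n x))\<^sup>2 \<le> K * (1 / 2) ^ n"
        using K[of n] by (simp add: norm_mult field_simps power_divide)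
      then have "sqrt ((cmod (d n x))\<^sup>2) \<le> sqrt (K * (1 / 2) ^ n)"
        by (rule real_sqrt_le_mono)
      then show "norm (d n x) \<le> sqrt K * (sqrt (1 / 2)) ^ n"
        by (simp add: real_sqrt_mult real_sqrt_power)
    qed
    then have "convergent (\<lambda>n. \<Sum>i<n. d i x)"
      by (simp add: summable_iff_convergent)
    moreover have "(\<Sum>i<n. d i x) = S n x - S 0 x" for n
      unfolding d_def by (rule sum_lessThan_telescope)
    ultimately have "convergent (\<lambda>n. S n x - S 0 x)" by simp
    then show "convergent (\<lambda>n. S n x)"
      by (simp add: convergent_diff_const_right_iff)
  qed
  define F where "F x = lim (\<lambda>n. S n x)" for x
  have [measurable]: "F \<in> borel_measurable M"
    unfolding F_def by measurable
  have lim: "AE x in M. (\<lambda>n. S n x) \<longlonglongrightarrow> F x"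
    using conv by eventually_elim (simp add: F_def convergent_LIMSEQ_iff)
  \<comment> \<open>The right-hand side is the exact geometric sum of the steps from n to n + k;
    keeping the subtracted term lets the induction close.\<close>
  have SS: "L2_norm M (\<lambda>x. S (n + k) x - S n x) \<le> 2 * (1 / 2) ^ n - 2 * (1 / 2) ^ (n + k)" for n k
  proof (induction k)
    case 0 then show ?case by (simp add: L2_norm_def)
  next
    case (Suc k)
    have "L2_norm M (\<lambda>x. S (n + Suc k) x - S n x)
        \<le> L2_norm M (\<lambda>x. S (n + Suc k) x - S (n + k) x) + L2_norm M (\<lambda>x. S (n + k) x - S n x)"
      by (rule L2_norm_diff_triangle[OF S S S])
    also have "\<dots> \<le> (1 / 2) ^ (n + k) + (2 * (1 / 2) ^ n - 2 * (1 / 2) ^ (n + k))"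
      using fast[of "n + k"] Suc.IH by (intro add_mono) auto
    finally show ?case by simp
  qed
  \<comment> \<open>Fatou: F - S n is the almost everywhere limit of S (k + n) - S n, whose norms
    are bounded uniformly in k.\<close>
  have sq: "L2_sq M (\<lambda>x. F x - S n x) \<le> ennreal ((2 * (1 / 2) ^ n)\<^sup>2)" for n
  proof -
    have "L2_sq M (\<lambda>x. F x - S n x) = (\<integral>\<^sup>+x. liminf (\<lambda>k. ennreal ((cmod (S (k + n) x - S n x))\<^sup>2)) \<partial>M)"
      unfolding L2_sq_def
    proof (rule nn_integral_cong_AE, use lim in eventually_elim)
      fix x assume "(\<lambda>k. S k x) \<longlonglongrightarrow> F x"
      then have "(\<lambda>k. S (k + n) x) \<longlonglongrightarrow> F x"
        by (rule LIMSEQ_ignore_initial_segment)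
      then have "(\<lambda>k. ennreal ((cmod (S (k + n) x - S n x))\<^sup>2)) \<longlonglongrightarrow> ennreal ((cmod (F x - S n x))\<^sup>2)"
        by (intro tendsto_intros)
      then show "ennreal ((cmod (F x - S n x))\<^sup>2) = liminf (\<lambda>k. ennreal ((cmod (S (k + n) x - S n x))\<^sup>2))"
        by (rule lim_imp_Liminf[OF sequentially_bot, symmetric])
    qed
    also have "\<dots> \<le> liminf (\<lambda>k. L2_sq M (\<lambda>x. S (k + n) x - S n x))"
      unfolding L2_sq_def by (rule nn_integral_liminf) simp
    also have "\<dots> \<le> limsup (\<lambda>k. L2_sq M (\<lambda>x. S (k + n) x - S n x))"
      by (rule Liminf_le_Limsup) simp
    also have "\<dots> \<le> ennreal ((2 * (1 / 2) ^ n)\<^sup>2)"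
    proof (rule Limsup_bounded, intro always_eventually allI)
      fix k
      have "L2_norm M (\<lambda>x. S (k + n) x - S n x) \<le> 2 * (1 / 2) ^ n - 2 * (1 / 2) ^ (k + n)"
        using SS[of n k] by (simp add: add.commute)
      also have "\<dots> \<le> 2 * (1 / 2) ^ n" by simp
      finally have "L2_norm M (\<lambda>x. S (k + n) x - S n x) \<le> 2 * (1 / 2) ^ n" .
      then show "L2_sq M (\<lambda>x. S (k + n) x - S n x) \<le> ennreal ((2 * (1 / 2) ^ n)\<^sup>2)"
        by (subst L2_sq_le_iff[symmetric]) (auto intro: L2_diff S)
    qed
    finally show ?thesis .
  qed
  have FS: "(\<lambda>x. F x - S n x) \<in> L2 M" for n
    using sq[of n] by (auto simp: L2_iff intro: le_less_trans)
  have "F \<in> L2 M"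
    using L2_add[OF FS[of 0] S[of 0]] by simp
  moreover have "L2_norm M (\<lambda>x. F x - S n x) \<le> 2 * (1 / 2) ^ n" for n
    using sq FS by (intro L2_norm_le) auto
  ultimately show ?thesis by blast
qed

section \<open>Characters of a countable abelian group\<close>

lemma dual_groupD:
  assumes "\<xi> \<in> dual_group"
  shows "\<xi> (s + t) = \<xi> s * \<xi> t" "cmod (\<xi> t) = 1"
  using assms by (auto simp: dual_group_def)

lemma dual_group_nonzero: "\<xi> \<in> dual_group \<Longrightarrow> \<xi> t \<noteq> 0"
  using dual_groupD(2)[of \<xi> t] by auto

lemma dual_group_zero: "\<xi> \<in> dual_group \<Longrightarrow> \<xi> 0 = 1"
  using dual_groupD(1)[of \<xi> 0 0] dual_group_nonzero[of \<xi> 0] by simp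

lemma dual_group_minus: "\<xi> \<in> dual_group \<Longrightarrow> \<xi> (- t) = cnj (\<xi> t)"
proof -
  assume \<xi>: "\<xi> \<in> dual_group"
  have "\<xi> (- t) * \<xi> t = 1"
    using dual_groupD(1)[OF \<xi>, of "- t" t] dual_group_zero[OF \<xi>] by simp
  moreover have "cnj (\<xi> t) * \<xi> t = 1"
    using dual_groupD(2)[OF \<xi>, of t] complex_norm_square[of "\<xi> t"] by (simp add: mult.commute)
  ultimately show ?thesis
    using dual_group_nonzero[OF \<xi>, of t] by (metis mult_right_cancel)
qed

lemma dual_add_closed: "\<xi> \<in> dual_group \<Longrightarrow> \<eta> \<in> dual_group \<Longrightarrow> dual_add \<xi> \<eta> \<in> dual_group"
  by (auto simp: dual_group_def dual_add_def norm_mult)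

lemma dual_cnj_closed: "\<xi> \<in> dual_group \<Longrightarrow> (\<lambda>t. cnj (\<xi> t)) \<in> dual_group"
  by (auto simp: dual_group_def)

lemma dual_add_cnj:
  assumes \<eta>: "\<eta> \<in> dual_group"
  shows "dual_add \<eta> (dual_add (\<lambda>t. cnj (\<eta> t)) \<xi>) = \<xi>"
    and "dual_add (\<lambda>t. cnj (\<eta> t)) (dual_add \<eta> \<xi>) = \<xi>"
proof -
  have "\<eta> t * cnj (\<eta> t) = 1" for t
    using dual_groupD(2)[OF \<eta>, of t] by (simp add: complex_norm_square[symmetric])
  then have 1: "\<eta> t * (cnj (\<eta> t) * z) = z" and 2: "cnj (\<eta> t) * (\<eta> t * z) = z" for t z
    by (metis mult.assoc mult_1, metis mult.assoc mult.commute mult_1)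
  show "dual_add \<eta> (dual_add (\<lambda>t. cnj (\<eta> t)) \<xi>) = \<xi>"
    "dual_add (\<lambda>t. cnj (\<eta> t)) (dual_add \<eta> \<xi>) = \<xi>"
    by (auto simp: dual_add_def 1 2)
qed

lemma dual_add_commute: "dual_add \<xi> \<eta> = dual_add \<eta> \<xi>"
  by (simp add: dual_add_def mult.commute)

lemma annihilator_dual: "\<eta> \<in> annihilator \<Gamma> \<Longrightarrow> \<eta> \<in> dual_group"
  by (simp add: annihilator_def)

section \<open>Extending characters from subgroups\<close>

primrec nmul :: "nat \<Rightarrow> 'g::ab_group_add \<Rightarrow> 'g" where
  "nmul 0 t = 0"
| "nmul (Suc n) t = t + nmul n t"

lemma nmul_add: "nmul (m + n) t = nmul m t + nmul n t"
  by (induction m) (auto simp: add.assoc)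

lemma nmul_mult: "nmul (m * n) t = nmul m (nmul n t)"
  by (induction m) (auto simp: nmul_add)

lemma dual_group_nmul: "\<xi> \<in> dual_group \<Longrightarrow> \<xi> (nmul n t) = \<xi> t ^ n"
  by (induction n) (auto simp: dual_group_zero dual_groupD)

text \<open>Graphs of partial characters: a subgroup of \<open>'g \<times> U(1)\<close> whose fibre over \<open>0\<close> is trivial.\<close>

definition char_graph :: "('g::ab_group_add \<times> complex) set \<Rightarrow> bool" where
  "char_graph G \<longleftrightarrow> (0, 1) \<in> G \<and> (\<forall>s a u b. (s, a) \<in> G \<longrightarrow> (u, b) \<in> G \<longrightarrow> (s - u, a / b) \<in> G) \<and>
     (\<forall>s a. (s, a) \<in> G \<longrightarrow> cmod a = 1) \<and> (\<forall>a. (0, a) \<in> G \<longrightarrow> a = 1)"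

lemma char_graphD:
  assumes "char_graph G"
  shows "(0, 1) \<in> G" "(s, a) \<in> G \<Longrightarrow> (u, b) \<in> G \<Longrightarrow> (s - u, a / b) \<in> G"
    "(s, a) \<in> G \<Longrightarrow> cmod a = 1" "(0, a) \<in> G \<Longrightarrow> a = 1"
  using assms unfolding char_graph_def by blast+

lemma char_graph_uminus: "char_graph G \<Longrightarrow> (s, a) \<in> G \<Longrightarrow> (- s, 1 / a) \<in> G"
  using char_graphD(2)[of G 0 1 s a] char_graphD(1)[of G] by simp

lemma char_graph_add: "char_graph G \<Longrightarrow> (s, a) \<in> G \<Longrightarrow> (u, b) \<in> G \<Longrightarrow> (s + u, a * b) \<in> G"
  using char_graphD(2)[of G s a "- u" "1 / b"] char_graph_uminus[of G u b] by simp

lemma char_graph_nmul: "char_graph G \<Longrightarrow> (s, a) \<in> G \<Longrightarrow> (nmul n s, a ^ n) \<in> G"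
  by (induction n) (auto simp: char_graphD(1) intro: char_graph_add)

lemma char_graph_unique: "char_graph G \<Longrightarrow> (s, a) \<in> G \<Longrightarrow> (s, b) \<in> G \<Longrightarrow> a = b"
  using char_graphD(2)[of G s a s b] char_graphD(4)[of G "a / b"] by (cases "b = 0") (auto dest: char_graphD(3))

text \<open>The multiples of t in the domain decide which values at t are admissible. If no positive
  multiple occurs, the value is free and -1 serves; otherwise z must be an n-th root of the value at
  the least positive multiple n t. A root other than 1 exists because t itself lies outside the
  domain, which gives n >= 2.\<close>

lemma char_graph_extension_value:
  assumes G: "char_graph G" and t: "\<And>a. (t, a) \<notin> G"
  shows "\<exists>z. cmod z = 1 \<and> z \<noteq> 1 \<and> (\<forall>k b. (nmul k t, b) \<in> G \<longrightarrow> z ^ k = b)"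
proof (cases "\<exists>k b. 0 < k \<and> (nmul k t, b) \<in> G")
  case False
  have *: "k = 0 \<and> b = 1" if "(nmul k t, b) \<in> G" for k b
  proof -
    have "k = 0" using False that by (meson not_gr_zero)
    then show ?thesis using that char_graphD(4)[OF G, of b] by simp
  qed
  have "(- 1 :: complex) ^ k = b" if "(nmul k t, b) \<in> G" for k b
    using *[OF that] by simp
  then show ?thesis by (intro exI[of _ "- 1"] conjI allI impI) simp_all
next
  case True
  define n where "n = (LEAST k. 0 < k \<and> (\<exists>b. (nmul k t, b) \<in> G))"
  have "0 < n \<and> (\<exists>b. (nmul n t, b) \<in> G)"
    unfolding n_def by (rule LeastI_ex[of "\<lambda>k. 0 < k \<and> (\<exists>b. (nmul k t, b) \<in> G)"]) (use True in blast)
  then obtain b where n0: "0 < n" and b: "(nmul n t, b) \<in> G" by blast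
  have least: "n \<le> k" if "0 < k" "(nmul k t, c) \<in> G" for k c
    unfolding n_def using that by (intro Least_le) auto
  have n2: "2 \<le> n"
  proof (rule ccontr)
    assume "\<not> 2 \<le> n"
    then have "n = Suc 0" using n0 by simp
    then show False using b t[of b] by simp
  qed
  have "\<exists>z. cmod z = 1 \<and> z \<noteq> 1 \<and> z ^ n = b"
  proof (cases "b = 1")
    case True
    \<comment> \<open>A nontrivial n-th root of unity: n >= 2 keeps the angle in the interval where
      cos decreases strictly from 1.\<close>
    have "cos (2 * pi / n) < cos 0"
      using n2 by (intro cos_monotone_0_pi) (auto simp: field_simps)
    then have "cis (2 * pi / n) \<noteq> 1" by (auto simp: complex_eq_iff)
    moreover have "cis (2 * pi / n) ^ n = 1"
      using n0 by (simp only: Complex.DeMoivre) simp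
    ultimately show ?thesis
      using True by (intro exI[of _ "cis (2 * pi / n)"]) auto
  next
    case False
    have b1: "cmod b = 1" by (rule char_graphD(3)[OF G b])
    then have "cis (Arg b) = b" using cis_Arg[of b] by (cases "b = 0") (auto simp: sgn_eq)
    then have root: "cis (Arg b / n) ^ n = b"
      using n0 by (simp only: Complex.DeMoivre) simp
    moreover have "cis (Arg b / n) \<noteq> 1" using False root by (metis power_one)
    ultimately show ?thesis
      by (intro exI[of _ "cis (Arg b / n)"]) auto
  qed
  then obtain z where z: "cmod z = 1" "z \<noteq> 1" "z ^ n = b" by blast
  have "z ^ k = c" if k: "(nmul k t, c) \<in> G" for k c
  proof -
    \<comment> \<open>Division with remainder: subtracting k div n copies of n t leaves a smaller
      multiple of t in the domain, so minimality of n forces the remainder to be 0.\<close>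
    have eq: "nmul k t - nmul (k div n) (nmul n t) = nmul (k mod n) t"
      using nmul_add[of "k div n * n" "k mod n" t] by (simp add: nmul_mult)
    have "(nmul (k mod n) t, c / b ^ (k div n)) \<in> G"
      using char_graphD(2)[OF G k char_graph_nmul[OF G b, of "k div n"]] by (simp only: eq)
    moreover from this have k0: "k mod n = 0"
      using least[of "k mod n"] mod_less_divisor[OF n0, of k] by fastforce
    ultimately have "c / b ^ (k div n) = 1"
      using char_graphD(4)[OF G, of "c / b ^ (k div n)"] by simp
    then have "c = b ^ (k div n)" by (simp add: divide_eq_1_iff)
    also have "\<dots> = z ^ (n * (k div n))"
      by (simp add: z(3)[symmetric] power_mult)
    also have "n * (k div n) = k" using k0 by auto
    finally show ?thesis ..
  qed
  then show ?thesis using z by blast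
qed

lemma char_graph_extend:
  assumes G: "char_graph G" and t: "\<And>a. (t, a) \<notin> G"
  shows "\<exists>G' z. char_graph G' \<and> G \<subseteq> G' \<and> (t, z) \<in> G' \<and> z \<noteq> 1"
proof -
  obtain z where z: "cmod z = 1" "z \<noteq> 1" and zk: "\<And>k b. (nmul k t, b) \<in> G \<Longrightarrow> z ^ k = b"
    using char_graph_extension_value[OF G t] by blast
  have z0: "z \<noteq> 0" using z(1) by auto
  \<comment> \<open>The subgroup generated by \<open>G\<close> and (t, z); the two naturals n and m
    encode the integer multiple n - m.\<close>
  define G' where "G' = {(s + nmul n t - nmul m t, a * z ^ n / z ^ m) | s a n m. (s, a) \<in> G}"
  have G'I: "(s + nmul n t - nmul m t, a * z ^ n / z ^ m) \<in> G'" if "(s, a) \<in> G" for s a n m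
    using that unfolding G'_def by blast
  have "G \<subseteq> G'" using G'I[of _ _ 0 0] by auto
  moreover have "(t, z) \<in> G'" using G'I[OF char_graphD(1)[OF G], of 1 0] by simp
  moreover have "char_graph G'"
    unfolding char_graph_def
  proof (intro conjI allI impI)
    show "(0, 1) \<in> G'" using \<open>G \<subseteq> G'\<close> char_graphD(1)[OF G] by blast
  next
    fix s' a' u' b' assume "(s', a') \<in> G'" "(u', b') \<in> G'"
    then obtain s a n m u b k l where
      "(s, a) \<in> G" "s' = s + nmul n t - nmul m t" "a' = a * z ^ n / z ^ m"
      "(u, b) \<in> G" "u' = u + nmul k t - nmul l t" "b' = b * z ^ k / z ^ l"
      unfolding G'_def by blast
    moreover from this have "(s - u, a / b) \<in> G" using char_graphD(2)[OF G] by blast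
    ultimately show "(s' - u', a' / b') \<in> G'"
      using G'I[of "s - u" "a / b" "n + l" "m + k"]
      by (simp add: nmul_add power_add) (simp add: algebra_simps)
  next
    fix s' a' assume "(s', a') \<in> G'"
    then show "cmod a' = 1"
      using z(1) char_graphD(3)[OF G] by (auto simp: G'_def norm_mult norm_divide norm_power)
  next
    \<comment> \<open>The constraint on z is used here: an element over 0 shows that a nonnegative
      multiple of t, equal to s or -s, lies in the domain of \<open>G\<close>, so the power of z is
      prescribed and cancels a. The sign of n - m decides which.\<close>
    fix a' assume "(0, a') \<in> G'"
    then obtain s a n m where sa: "(s, a) \<in> G" and eq: "s + nmul n t - nmul m t = 0"
      and a': "a' = a * z ^ n / z ^ m"
      unfolding G'_def by auto
    have a0: "a \<noteq> 0" using char_graphD(3)[OF G sa] by auto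
    show "a' = 1"
    proof (cases "m \<le> n")
      case True
      then obtain k where n: "n = m + k" using le_Suc_ex by blast
      then have "nmul k t = - s" using eq by (simp add: nmul_add algebra_simps eq_neg_iff_add_eq_0)
      then have "z ^ k = 1 / a" using zk char_graph_uminus[OF G sa] by simp
      then show ?thesis using a0 z0 by (simp add: a' n power_add)
    next
      case False
      then obtain k where n: "m = n + k" using le_Suc_ex[of n m] by auto
      then have "nmul k t = s" using eq by (simp add: nmul_add algebra_simps)
      then have "z ^ k = a" using zk sa by simp
      then show ?thesis using a0 z0 by (simp add: a' n power_add)
    qed
  qed
  ultimately show ?thesis using z(2) by blast
qed

lemma char_graph_Union:
  assumes "\<C> \<noteq> {}" and ch: "\<And>G G'. G \<in> \<C> \<Longrightarrow> G' \<in> \<C> \<Longrightarrow> G \<subseteq> G' \<or> G' \<subseteq> G"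
    and G: "\<And>G. G \<in> \<C> \<Longrightarrow> char_graph G"
  shows "char_graph (\<Union>\<C>)"
  unfolding char_graph_def
proof (intro conjI allI impI)
  show "(0, 1) \<in> \<Union>\<C>" using assms(1) char_graphD(1)[OF G] by blast
next
  fix s a u b assume "(s, a) \<in> \<Union>\<C>" "(u, b) \<in> \<Union>\<C>"
  then obtain X Y where XY: "X \<in> \<C>" "Y \<in> \<C>" "(s, a) \<in> X" "(u, b) \<in> Y" by blast
  then obtain Z where "Z \<in> \<C>" "(s, a) \<in> Z" "(u, b) \<in> Z" using ch[of X Y] by blast
  then show "(s - u, a / b) \<in> \<Union>\<C>" using char_graphD(2)[OF G] by blast
next
  fix s a assume "(s, a) \<in> \<Union>\<C>"
  then show "cmod a = 1" using char_graphD(3)[OF G] by blast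
next
  fix a assume "(0, a) \<in> \<Union>\<C>"
  then show "a = 1" using char_graphD(4)[OF G] by blast
qed

text \<open>The trivial character of \<open>H\<close> is first extended to t with a value other than
  1 and then, by Zorn's lemma, to the whole group. \<open>H\<close> = {0} is used for orthogonality
  of characters, \<open>H\<close> = \<Gamma> for averaging over the annihilator.\<close>

lemma annihilator_separates:
  assumes H: "add_subgroup H" and t: "t \<notin> H"
  shows "\<exists>\<eta>\<in>annihilator H. \<eta> t \<noteq> 1"
proof -
  have "char_graph (H \<times> {1})"
    using H by (auto simp: char_graph_def add_subgroup_def) (metis diff_conv_add_uminus)
  then obtain G1 z where G1: "char_graph G1" "H \<times> {1} \<subseteq> G1" "(t, z) \<in> G1" "z \<noteq> 1"
    using char_graph_extend[of "H \<times> {1}" t] t by auto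
  \<comment> \<open>Only graphs above \<open>G1\<close> compete, so the maximal one keeps the value
    z at t.\<close>
  have "\<exists>G\<in>{G. char_graph G \<and> G1 \<subseteq> G}. \<forall>X\<in>{G. char_graph G \<and> G1 \<subseteq> G}. G \<subseteq> X \<longrightarrow> X = G"
  proof (rule subset_Zorn_nonempty)
    show "{G. char_graph G \<and> G1 \<subseteq> G} \<noteq> {}" using G1 by blast
  next
    fix \<C> assume "\<C> \<noteq> {}" and ch: "subset.chain {G. char_graph G \<and> G1 \<subseteq> G} \<C>"
    then have "char_graph (\<Union>\<C>)"
      by (intro char_graph_Union) (unfold subset.chain_def, blast+)
    moreover have "G1 \<subseteq> \<Union>\<C>"
      using ch \<open>\<C> \<noteq> {}\<close> unfolding subset.chain_def by blast
    ultimately show "\<Union>\<C> \<in> {G. char_graph G \<and> G1 \<subseteq> G}" by blast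
  qed
  then obtain G where "G \<in> {G. char_graph G \<and> G1 \<subseteq> G}"
    and mx: "\<forall>X\<in>{G. char_graph G \<and> G1 \<subseteq> G}. G \<subseteq> X \<longrightarrow> X = G"
    by (rule bexE)
  then have G: "char_graph G" "G1 \<subseteq> G" by simp_all
  have max: "X = G" if "char_graph X" "G \<subseteq> X" for X
    using bspec[OF mx, of X] that G(2) by simp
  have total: "\<exists>a. (s, a) \<in> G" for s
  proof (rule ccontr)
    assume "\<nexists>a. (s, a) \<in> G"
    then obtain G' z where "char_graph G'" "G \<subseteq> G'" "(s, z) \<in> G'"
      using char_graph_extend[OF G(1), of s] by blast
    then show False using max[of G'] \<open>\<nexists>a. (s, a) \<in> G\<close> by blast
  qed
  define \<eta> where "\<eta> s = (SOME a. (s, a) \<in> G)" for s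
  have \<eta>: "(s, \<eta> s) \<in> G" for s
    unfolding \<eta>_def using total by (rule someI_ex)
  have uniq: "\<eta> s = a" if "(s, a) \<in> G" for s a
    using char_graph_unique[OF G(1) \<eta> that] .
  have "\<eta> \<in> dual_group"
    unfolding dual_group_def
    using char_graph_add[OF G(1) \<eta> \<eta>] char_graphD(3)[OF G(1) \<eta>] by (auto intro: uniq)
  moreover have "\<eta> \<gamma> = 1" if "\<gamma> \<in> H" for \<gamma>
    using that G1 G by (intro uniq) auto
  moreover have "\<eta> t \<noteq> 1"
    using G1 G uniq[of t z] by auto
  ultimately show ?thesis by (auto simp: annihilator_def)
qed

lemma add_subgroup_0: "add_subgroup {0}"
  by (simp add: add_subgroup_def)

section \<open>Haar measure\<close>

lemma measurable_coord_borel: "(\<lambda>\<xi>::'g::countable \<Rightarrow> complex. \<xi> t) \<in> borel_measurable borel"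
  by (intro borel_measurable_continuous_onI) simp

context
  fixes m :: "('g::{ab_group_add, countable} \<Rightarrow> complex) measure"
  assumes sets_m: "sets m = sets (restrict_space borel dual_group)"
begin

lemma space_dual: "space m = dual_group"
  using sets_eq_imp_space_eq[OF sets_m] by (simp add: space_restrict_space)

lemma measurable_dual_borel: "f \<in> borel_measurable borel \<Longrightarrow> f \<in> borel_measurable m"
  using measurable_cong_sets[OF sets_m refl, of borel] measurable_restrict_space1 by blast

lemma measurable_coord: "(\<lambda>\<xi>. \<xi> t) \<in> borel_measurable m"
  by (rule measurable_dual_borel[OF measurable_coord_borel])

lemma measurable_dual_add:
  assumes "\<eta> \<in> dual_group"
  shows "dual_add \<eta> \<in> measurable m m"
proof -
  have "continuous_on UNIV (dual_add \<eta>)"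
    unfolding dual_add_def
    by (intro continuous_on_coordinatewise_then_product continuous_intros) simp
  then have "dual_add \<eta> \<in> measurable borel borel"
    by (rule borel_measurable_continuous_onI)
  then have "dual_add \<eta> \<in> measurable (restrict_space borel dual_group) (restrict_space borel dual_group)"
    by (intro measurable_restrict_space3) (auto intro: dual_add_closed assms)
  then show ?thesis
    using measurable_cong_sets[OF sets_m sets_m] by blast
qed

end

lemma dual_haar_sets: "dual_haar m \<Longrightarrow> sets m = sets (restrict_space borel dual_group)"
  by (simp add: dual_haar_def)

lemma dual_haar_finite: "dual_haar m \<Longrightarrow> finite_measure m"
  by (rule finite_measureI) (metis dual_haar_def ennreal_one_neq_top infinity_ennreal_def)

text \<open>Haar invariance is stated for images, whereas \<open>distr\<close> uses preimages; the
  preimage under translation by \<eta> is the image under translation by the conjugate character,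
  the inverse of \<eta>.\<close>

lemma distr_dual_add:
  assumes m: "dual_haar m" and \<eta>: "\<eta> \<in> dual_group"
  shows "distr m m (dual_add \<eta>) = m"
proof (rule measure_eqI)
  note sm = dual_haar_sets[OF m]
  fix A assume "A \<in> sets (distr m m (dual_add \<eta>))"
  then have A: "A \<in> sets m" by simp
  have AD: "A \<subseteq> dual_group"
    using sets.sets_into_space[OF A] by (simp add: space_dual[OF sm])
  let ?\<eta> = "\<lambda>t. cnj (\<eta> t)"
  have "dual_add \<eta> -` A \<inter> space m = dual_add ?\<eta> ` A"
  proof (intro equalityI subsetI)
    fix \<xi> assume "\<xi> \<in> dual_add \<eta> -` A \<inter> space m"
    then show "\<xi> \<in> dual_add ?\<eta> ` A"
      using dual_add_cnj(2)[OF \<eta>, of \<xi>] by (metis Int_iff image_eqI vimageD)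
  next
    fix \<zeta> assume "\<zeta> \<in> dual_add ?\<eta> ` A"
    then obtain \<xi> where \<xi>: "\<xi> \<in> A" "\<zeta> = dual_add ?\<eta> \<xi>" by blast
    moreover have "dual_add ?\<eta> \<xi> \<in> space m"
      using \<xi> AD dual_cnj_closed[OF \<eta>] by (auto simp: space_dual[OF sm] intro: dual_add_closed)
    ultimately show "\<zeta> \<in> dual_add \<eta> -` A \<inter> space m"
      by (simp add: dual_add_cnj(1)[OF \<eta>])
  qed
  then show "emeasure (distr m m (dual_add \<eta>)) A = emeasure m A"
    using m A dual_cnj_closed[OF \<eta>]
    by (simp add: emeasure_distr measurable_dual_add[OF sm \<eta>] dual_haar_def)
qed simp

text \<open>Translating by a character with \<eta> t different from 1 multiplies the integral by
  \<eta> t and, by invariance, does not change it.\<close>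

lemma integral_character_zero:
  assumes m: "dual_haar m" and t: "t \<noteq> 0"
  shows "(\<integral>\<xi>. \<xi> t \<partial>m) = 0"
proof -
  note sm = dual_haar_sets[OF m]
  obtain \<eta> where \<eta>: "\<eta> \<in> dual_group" "\<eta> t \<noteq> 1"
    using annihilator_separates[OF add_subgroup_0, of t] t by (auto simp: annihilator_def)
  have "(\<integral>\<xi>. \<xi> t \<partial>m) = (\<integral>\<xi>. \<xi> t \<partial>(distr m m (dual_add \<eta>)))"
    by (simp add: distr_dual_add[OF m \<eta>(1)])
  also have "\<dots> = (\<integral>\<xi>. dual_add \<eta> \<xi> t \<partial>m)"
    by (rule integral_distr[OF measurable_dual_add[OF sm \<eta>(1)] measurable_coord[OF sm]])
  also have "\<dots> = \<eta> t * (\<integral>\<xi>. \<xi> t \<partial>m)"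
    by (simp add: dual_add_def)
  finally show ?thesis using \<eta>(2) by simp
qed

section \<open>Density of trigonometric polynomials\<close>

text \<open>Building polynomials one term at a time gives an induction rule and tolerates repeated
  frequencies. The members are defined on all functions from the group to the complex numbers, so
  continuity and periodicity hold without restriction to characters.\<close>

inductive_set trig :: "'g set \<Rightarrow> (('g \<Rightarrow> complex) \<Rightarrow> complex) set" for \<Gamma> where
  zero: "(\<lambda>_. 0) \<in> trig \<Gamma>"
| step: "p \<in> trig \<Gamma> \<Longrightarrow> t \<in> \<Gamma> \<Longrightarrow> (\<lambda>\<xi>. p \<xi> + c * \<xi> t) \<in> trig \<Gamma>"

lemma trig_monom: "t \<in> \<Gamma> \<Longrightarrow> (\<lambda>\<xi>. c * \<xi> t) \<in> trig \<Gamma>"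
  using trig.step[OF trig.zero, of t \<Gamma> c] by simp

lemma trig_add: "p \<in> trig \<Gamma> \<Longrightarrow> q \<in> trig \<Gamma> \<Longrightarrow> (\<lambda>\<xi>. p \<xi> + q \<xi>) \<in> trig \<Gamma>"
proof (induction p rule: trig.induct)
  case (step p t c)
  then show ?case using trig.step[of "\<lambda>\<xi>. p \<xi> + q \<xi>" \<Gamma> t c] by (simp add: ac_simps)
qed simp

lemma trig_scale: "p \<in> trig \<Gamma> \<Longrightarrow> (\<lambda>\<xi>. a * p \<xi>) \<in> trig \<Gamma>"
proof (induction p rule: trig.induct)
  case (step p t c)
  then show ?case using trig.step[of "\<lambda>\<xi>. a * p \<xi>" \<Gamma> t "a * c"] by (simp add: algebra_simps)
qed (simp add: trig.zero)

text \<open>Frequencies add under multiplication only because \<xi> is multiplicative, so the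
  product is matched on characters alone.\<close>

lemma trig_mult_monom: "p \<in> trig UNIV \<Longrightarrow> \<exists>r\<in>trig UNIV. \<forall>\<xi>\<in>dual_group. r \<xi> = p \<xi> * (a * \<xi> s)"
proof (induction p rule: trig.induct)
  case zero
  then show ?case by (intro bexI[OF _ trig.zero]) simp
next
  case (step p t c)
  then obtain r where r: "r \<in> trig UNIV" "\<forall>\<xi>\<in>dual_group. r \<xi> = p \<xi> * (a * \<xi> s)" by blast
  show ?case
    by (rule bexI[OF _ trig.step[OF r(1), of "t + s" "c * a"]])
       (auto simp: r(2) dual_groupD(1) algebra_simps)
qed

lemma trig_mult:
  "q \<in> trig UNIV \<Longrightarrow> p \<in> trig UNIV \<Longrightarrow> \<exists>r\<in>trig UNIV. \<forall>\<xi>\<in>dual_group. r \<xi> = p \<xi> * q \<xi>"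
proof (induction q rule: trig.induct)
  case zero
  then show ?case by (intro bexI[OF _ trig.zero]) simp
next
  case (step q t c)
  then obtain r r' where r: "r \<in> trig UNIV" "\<forall>\<xi>\<in>dual_group. r \<xi> = p \<xi> * q \<xi>"
    "r' \<in> trig UNIV" "\<forall>\<xi>\<in>dual_group. r' \<xi> = p \<xi> * (c * \<xi> t)"
    using trig_mult_monom by blast
  show ?case
    by (rule bexI[OF _ trig_add[OF r(1,3)]]) (auto simp: r algebra_simps)
qed

lemma continuous_on_trig: "p \<in> trig \<Gamma> \<Longrightarrow> continuous_on S p"
  by (induction p rule: trig.induct) 
    (auto intro!: continuous_intros continuous_on_subset[OF continuous_on_product_coordinates])

lemma trig_periodic:
  assumes "p \<in> trig \<Gamma>" "\<eta> \<in> annihilator \<Gamma>"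
  shows "p (dual_add \<xi> \<eta>) = p \<xi>"
  using assms by (induction p rule: trig.induct) (auto simp: dual_add_def annihilator_def)

lemma trig_bounded: "p \<in> trig \<Gamma> \<Longrightarrow> \<exists>K. \<forall>\<xi>\<in>dual_group. cmod (p \<xi>) \<le> K"
proof (induction p rule: trig.induct)
  case (step p t c)
  then obtain K where K: "\<forall>\<xi>\<in>dual_group. cmod (p \<xi>) \<le> K" by blast
  have "cmod (p \<xi> + c * \<xi> t) \<le> K + cmod c" if "\<xi> \<in> dual_group" for \<xi>
    using K that norm_triangle_ineq[of "p \<xi>" "c * \<xi> t"] by (fastforce simp: norm_mult dual_groupD(2))
  then show ?case by blast
qed auto

lemma closed_dual_group: "closed (dual_group :: ('g::ab_group_add \<Rightarrow> complex) set)"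
proof -
  have 1: "closed {\<xi> :: 'g \<Rightarrow> complex. (\<forall>s t. \<xi> (s + t) = \<xi> s * \<xi> t)}"
    by (intro closed_Collect_all closed_Collect_eq continuous_intros) simp_all
  have 2: "closed {\<xi> :: 'g \<Rightarrow> complex. \<forall>t. cmod (\<xi> t) = 1}"
    by (intro closed_Collect_all closed_Collect_eq continuous_intros) simp_all
  show ?thesis
    unfolding dual_group_def using closed_Int[OF 1 2] by (simp only: Collect_conj_eq)
qed

text \<open>By Tychonoff, the dual is a closed subset of a compact product of unit circles.\<close>

lemma compact_dual_group: "compact (dual_group :: ('g::ab_group_add \<Rightarrow> complex) set)"
proof -
  have "compactin (product_topology (\<lambda>_. euclidean) UNIV) (Pi\<^sub>E (UNIV :: 'g set) (\<lambda>_. sphere (0::complex) 1))"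
    by (subst compactin_PiE) auto
  then have "compact (Pi\<^sub>E (UNIV :: 'g set) (\<lambda>_. sphere (0::complex) 1))"
    by (simp add: euclidean_product_topology)
  moreover have "dual_group \<subseteq> Pi\<^sub>E (UNIV :: 'g set) (\<lambda>_. sphere (0::complex) 1)"
    by (auto simp: dual_group_def)
  ultimately show ?thesis
    using closed_dual_group compact_Int_closed[of _ dual_group] by (metis inf.absorb2)
qed

text \<open>Stone-Weierstrass is applied to the algebra of real functions that agree on the dual
  with a trigonometric polynomial. Complex functions are reached later, through complex combinations
  of indicators.\<close>

lemma trig_uniform_dense:
  fixes \<phi> :: "('g::{ab_group_add, countable} \<Rightarrow> complex) \<Rightarrow> real"
  assumes \<phi>: "continuous_on dual_group \<phi>" and e: "0 < e"
  shows "\<exists>p\<in>trig UNIV. \<forall>\<xi>\<in>dual_group. cmod (of_real (\<phi> \<xi>) - p \<xi>) < e"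
proof -
  define P where "P f \<longleftrightarrow> (\<exists>p\<in>trig UNIV. \<forall>\<xi>\<in>dual_group. p \<xi> = complex_of_real (f \<xi>))"
    for f :: "('g \<Rightarrow> complex) \<Rightarrow> real"
  have "\<exists>g. P g \<and> (\<forall>\<xi>\<in>dual_group. \<bar>\<phi> \<xi> - g \<xi>\<bar> < e)"
  proof (rule Stone_Weierstrass_HOL[where S = dual_group and P = P and f = \<phi> and e = e])
    show "compact (dual_group :: ('g \<Rightarrow> complex) set)" by (rule compact_dual_group)
    show "continuous_on dual_group \<phi>" "0 < e" by (rule \<phi> e)+
    show "P (\<lambda>_. c)" for c
      unfolding P_def
      by (rule bexI[OF _ trig_monom[of 0 UNIV "of_real c"]]) (auto simp: dual_group_zero)
  next
    fix f assume "P f"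
    then obtain p where p: "p \<in> trig UNIV" "\<forall>\<xi>\<in>dual_group. p \<xi> = complex_of_real (f \<xi>)"
      unfolding P_def by blast
    have "continuous_on dual_group (\<lambda>\<xi>. Re (p \<xi>))"
      by (intro continuous_intros continuous_on_trig[OF p(1)])
    then show "continuous_on dual_group f"
      by (rule continuous_on_eq) (simp add: p(2))
  next
    fix f g assume "P f \<and> P g"
    then obtain p q where p: "p \<in> trig UNIV" "\<forall>\<xi>\<in>dual_group. p \<xi> = complex_of_real (f \<xi>)"
      and q: "q \<in> trig UNIV" "\<forall>\<xi>\<in>dual_group. q \<xi> = complex_of_real (g \<xi>)"
      unfolding P_def by blast
    show "P (\<lambda>x. f x + g x)"
      unfolding P_def by (rule bexI[OF _ trig_add[OF p(1) q(1)]]) (simp add: p q)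
    obtain r where r: "r \<in> trig UNIV" "\<forall>\<xi>\<in>dual_group. r \<xi> = p \<xi> * q \<xi>"
      using trig_mult[OF q(1) p(1)] by blast
    show "P (\<lambda>x. f x * g x)"
      unfolding P_def by (rule bexI[OF _ r(1)]) (simp add: p q r)
  next
    fix \<xi> \<zeta> :: "'g \<Rightarrow> complex" assume "\<xi> \<in> dual_group \<and> \<zeta> \<in> dual_group \<and> \<xi> \<noteq> \<zeta>"
    then obtain t where t: "\<xi> t \<noteq> \<zeta> t" by auto
    \<comment> \<open>On characters, \<xi> (- t) is the conjugate of \<xi> t, so real and imaginary
      parts of a coordinate are polynomials with frequencies t and - t.\<close>
    have "P (\<lambda>\<xi>. Re (\<xi> t))"
      unfolding P_def
      by (rule bexI[OF _ trig_add[OF trig_monom[of t UNIV "1 / 2"] trig_monom[of "- t" UNIV "1 / 2"]]])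
         (auto simp: dual_group_minus complex_eq_iff)
    moreover have "P (\<lambda>\<xi>. Im (\<xi> t))"
      unfolding P_def
      by (rule bexI[OF _ trig_add[OF trig_monom[of t UNIV "- \<i> / 2"] trig_monom[of "- t" UNIV "\<i> / 2"]]])
         (auto simp: dual_group_minus complex_eq_iff)
    ultimately show "\<exists>f. P f \<and> f \<xi> \<noteq> f \<zeta>"
      using t by (auto simp: complex_eq_iff)
  qed
  then obtain g p where "\<forall>\<xi>\<in>dual_group. \<bar>\<phi> \<xi> - g \<xi>\<bar> < e" "p \<in> trig UNIV"
    "\<forall>\<xi>\<in>dual_group. p \<xi> = complex_of_real (g \<xi>)"
    unfolding P_def by blast
  then show ?thesis
    by (intro bexI[of _ p]) (auto simp: of_real_diff[symmetric] simp del: of_real_diff)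
qed

section \<open>Density in L2 of an arbitrary finite Borel measure on the dual\<close>

definition trig_approx :: "('g::{ab_group_add, countable} \<Rightarrow> complex) measure \<Rightarrow> (('g \<Rightarrow> complex) \<Rightarrow> complex) \<Rightarrow> bool"
  where "trig_approx \<nu> f \<longleftrightarrow> f \<in> L2 \<nu> \<and> (\<forall>e>0. \<exists>p\<in>trig UNIV. L2_norm \<nu> (\<lambda>\<xi>. f \<xi> - p \<xi>) < e)"

context
  fixes \<nu> :: "('g::{ab_group_add, countable} \<Rightarrow> complex) measure"
  assumes sets_\<nu>: "sets \<nu> = sets (restrict_space borel dual_group)"
    and fin_\<nu>: "finite_measure \<nu>"
begin

interpretation finite_measure \<nu> by (rule fin_\<nu>)

lemma trig_measurable: "p \<in> trig \<Gamma> \<Longrightarrow> p \<in> borel_measurable \<nu>"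
  by (intro measurable_dual_borel[OF sets_\<nu>] borel_measurable_continuous_onI continuous_on_trig)

lemma L2_norm_bounded:
  assumes f: "f \<in> borel_measurable \<nu>" and K: "\<And>\<xi>. \<xi> \<in> dual_group \<Longrightarrow> cmod (f \<xi>) \<le> K"
  shows "f \<in> L2 \<nu>" "L2_norm \<nu> f \<le> sqrt (K\<^sup>2 * measure \<nu> (space \<nu>))"
proof -
  have le: "(cmod (f \<xi>))\<^sup>2 \<le> K\<^sup>2" if "\<xi> \<in> space \<nu>" for \<xi>
    using K[of \<xi>] that by (intro power_mono) (auto simp: space_dual[OF sets_\<nu>])
  show "f \<in> L2 \<nu>"
    unfolding L2_def using f le by (auto intro!: integrable_const_bound[of _ "K\<^sup>2"])
  then have "(\<integral>\<xi>. (cmod (f \<xi>))\<^sup>2 \<partial>\<nu>) \<le> (\<integral>\<xi>. K\<^sup>2 \<partial>\<nu>)"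
    using le by (intro integral_mono) (auto simp: L2_def)
  then show "L2_norm \<nu> f \<le> sqrt (K\<^sup>2 * measure \<nu> (space \<nu>))"
    unfolding L2_norm_def by (intro real_sqrt_le_mono) (simp add: mult.commute)
qed

lemma trig_L2: "p \<in> trig \<Gamma> \<Longrightarrow> p \<in> L2 \<nu>"
  using trig_bounded[of p \<Gamma>] L2_norm_bounded(1)[OF trig_measurable] by blast

lemma trig_approxI:
  assumes f: "f \<in> L2 \<nu>" and ap: "\<And>e. 0 < e \<Longrightarrow> \<exists>g. trig_approx \<nu> g \<and> L2_norm \<nu> (\<lambda>\<xi>. f \<xi> - g \<xi>) < e"
  shows "trig_approx \<nu> f"
  unfolding trig_approx_def
proof (intro conjI f allI impI)
  fix e :: real assume "0 < e"
  then obtain g where g: "trig_approx \<nu> g" "L2_norm \<nu> (\<lambda>\<xi>. f \<xi> - g \<xi>) < e / 2"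
    using ap[of "e / 2"] by auto
  then obtain p where p: "p \<in> trig UNIV" "L2_norm \<nu> (\<lambda>\<xi>. g \<xi> - p \<xi>) < e / 2"
    using \<open>0 < e\<close> unfolding trig_approx_def by (meson half_gt_zero)
  have "L2_norm \<nu> (\<lambda>\<xi>. f \<xi> - p \<xi>) \<le> L2_norm \<nu> (\<lambda>\<xi>. f \<xi> - g \<xi>) + L2_norm \<nu> (\<lambda>\<xi>. g \<xi> - p \<xi>)"
    using f g(1) trig_L2[OF p(1)] by (intro L2_norm_diff_triangle) (auto simp: trig_approx_def)
  also have "\<dots> < e" using g(2) p(2) by simp
  finally show "\<exists>p\<in>trig UNIV. L2_norm \<nu> (\<lambda>\<xi>. f \<xi> - p \<xi>) < e" using p(1) by blast
qed

lemma trig_approx_zero: "trig_approx \<nu> (\<lambda>_. 0)"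
  unfolding trig_approx_def
  by (auto intro!: bexI[OF _ trig.zero] L2_zero simp: L2_norm_def)

lemma trig_approx_add:
  assumes f: "trig_approx \<nu> f" and g: "trig_approx \<nu> g"
  shows "trig_approx \<nu> (\<lambda>\<xi>. f \<xi> + g \<xi>)"
  unfolding trig_approx_def
proof (intro conjI allI impI)
  have fL: "f \<in> L2 \<nu>" and gL: "g \<in> L2 \<nu>" using f g by (auto simp: trig_approx_def)
  then show "(\<lambda>\<xi>. f \<xi> + g \<xi>) \<in> L2 \<nu>" by (rule L2_add)
  fix e :: real assume "0 < e"
  then obtain p q where p: "p \<in> trig UNIV" "L2_norm \<nu> (\<lambda>\<xi>. f \<xi> - p \<xi>) < e / 2"
    and q: "q \<in> trig UNIV" "L2_norm \<nu> (\<lambda>\<xi>. g \<xi> - q \<xi>) < e / 2"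
    using f g unfolding trig_approx_def by (meson half_gt_zero)
  have "L2_norm \<nu> (\<lambda>\<xi>. (f \<xi> + g \<xi>) - (p \<xi> + q \<xi>)) = L2_norm \<nu> (\<lambda>\<xi>. (f \<xi> - p \<xi>) + (g \<xi> - q \<xi>))"
    by (simp add: algebra_simps)
  also have "\<dots> \<le> L2_norm \<nu> (\<lambda>\<xi>. f \<xi> - p \<xi>) + L2_norm \<nu> (\<lambda>\<xi>. g \<xi> - q \<xi>)"
    by (intro L2_norm_triangle L2_diff fL gL trig_L2[OF p(1)] trig_L2[OF q(1)])
  also have "\<dots> < e" using p(2) q(2) by simp
  finally show "\<exists>p\<in>trig UNIV. L2_norm \<nu> (\<lambda>\<xi>. f \<xi> + g \<xi> - p \<xi>) < e"
    by (intro bexI[OF _ trig_add[OF p(1) q(1)]])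
qed

lemma trig_approx_scale:
  assumes f: "trig_approx \<nu> f"
  shows "trig_approx \<nu> (\<lambda>\<xi>. c * f \<xi>)"
  unfolding trig_approx_def
proof (intro conjI allI impI)
  show "(\<lambda>\<xi>. c * f \<xi>) \<in> L2 \<nu>" using f by (auto simp: trig_approx_def intro: L2_scale)
  fix e :: real assume e: "0 < e"
  have "0 < e / (cmod c + 1)" using e by (intro divide_pos_pos) (auto intro: add_nonneg_pos)
  then obtain p where p: "p \<in> trig UNIV" "L2_norm \<nu> (\<lambda>\<xi>. f \<xi> - p \<xi>) < e / (cmod c + 1)"
    using f unfolding trig_approx_def by blast
  have "L2_norm \<nu> (\<lambda>\<xi>. c * f \<xi> - c * p \<xi>) = cmod c * L2_norm \<nu> (\<lambda>\<xi>. f \<xi> - p \<xi>)"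
    by (simp add: L2_norm_scale[symmetric] right_diff_distrib)
  also have "\<dots> \<le> cmod c * (e / (cmod c + 1))"
    using p(2) by (intro mult_left_mono) auto
  also have "\<dots> < e"
    using e by (simp add: pos_divide_less_eq add_nonneg_pos)
  finally show "\<exists>p\<in>trig UNIV. L2_norm \<nu> (\<lambda>\<xi>. c * f \<xi> - p \<xi>) < e"
    by (intro bexI[OF _ trig_scale[OF p(1), of c]])
qed

lemma trig_approx_sum:
  "(\<And>i. i \<in> I \<Longrightarrow> trig_approx \<nu> (f i)) \<Longrightarrow> trig_approx \<nu> (\<lambda>\<xi>. \<Sum>i\<in>I. f i \<xi>)"
  by (induction I rule: infinite_finite_induct) (auto intro: trig_approx_add trig_approx_zero)

lemma trig_approx_continuous:
  fixes \<phi> :: "('g \<Rightarrow> complex) \<Rightarrow> real"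
  assumes \<phi>: "continuous_on UNIV \<phi>"
  shows "trig_approx \<nu> (\<lambda>\<xi>. complex_of_real (\<phi> \<xi>))"
  unfolding trig_approx_def
proof (intro conjI allI impI)
  have "(\<lambda>\<xi>. complex_of_real (\<phi> \<xi>)) \<in> borel_measurable borel"
    using \<phi> by (intro borel_measurable_continuous_onI continuous_intros)
  then have m: "(\<lambda>\<xi>. complex_of_real (\<phi> \<xi>)) \<in> borel_measurable \<nu>"
    by (rule measurable_dual_borel[OF sets_\<nu>])
  have \<phi>d: "continuous_on dual_group \<phi>" using \<phi> continuous_on_subset by blast
  have "bounded (\<phi> ` dual_group)"
    by (intro compact_imp_bounded compact_continuous_image compact_dual_group \<phi>d)
  then obtain K where "\<And>\<xi>. \<xi> \<in> dual_group \<Longrightarrow> cmod (complex_of_real (\<phi> \<xi>)) \<le> K"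
    by (auto simp: bounded_iff)
  then show "(\<lambda>\<xi>. complex_of_real (\<phi> \<xi>)) \<in> L2 \<nu>"
    by (rule L2_norm_bounded(1)[OF m])
  fix e :: real assume e: "0 < e"
  let ?V = "measure \<nu> (space \<nu>)"
  define d where "d = e / (sqrt ?V + 1)"
  have d: "0 < d" using e by (auto simp: d_def intro!: divide_pos_pos add_nonneg_pos)
  obtain p where p: "p \<in> trig UNIV" "\<forall>\<xi>\<in>dual_group. cmod (of_real (\<phi> \<xi>) - p \<xi>) < d"
    using trig_uniform_dense[OF \<phi>d d] by blast
  have "L2_norm \<nu> (\<lambda>\<xi>. of_real (\<phi> \<xi>) - p \<xi>) \<le> sqrt (d\<^sup>2 * ?V)"
    using p(2) trig_measurable[OF p(1)] m by (intro L2_norm_bounded(2)) (auto intro: less_imp_le)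
  also have "\<dots> = d * sqrt ?V" using d by (simp add: real_sqrt_mult)
  also have "\<dots> < e"
    using e by (simp add: d_def pos_divide_less_eq add_nonneg_pos)
  finally show "\<exists>p\<in>trig UNIV. L2_norm \<nu> (\<lambda>\<xi>. of_real (\<phi> \<xi>) - p \<xi>) < e"
    using p(1) by blast
qed

text \<open>Regularity squeezes A between a compact K and an open U. A Urysohn function differs from
  the indicator of A only on U - K, and by at most 1, so the squared L2 distance is bounded by the
  mass of U - K.\<close>

lemma trig_approx_indicator:
  assumes A: "A \<in> sets \<nu>"
  shows "trig_approx \<nu> (indicator A)"
proof (rule trig_approxI)
  show L2A: "(indicator A :: _ \<Rightarrow> complex) \<in> L2 \<nu>"
    using A by (intro L2_norm_bounded(1)[of _ 1]) (auto simp: indicator_def)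
  fix e :: real assume e: "0 < e"
  have idm: "(\<lambda>\<xi>. \<xi>) \<in> measurable \<nu> borel"
    unfolding measurable_cong_sets[OF sets_\<nu> refl]
    by (rule measurable_restrict_space1[OF measurable_ident_sets[OF refl]])
  \<comment> \<open>Regularity concerns measures on the full Borel sigma-algebra, so \<nu> is
    transported from the dual to the surrounding function space.\<close>
  define \<mu> where "\<mu> = distr \<nu> borel (\<lambda>\<xi>. \<xi>)"
  have em: "emeasure \<mu> B = emeasure \<nu> (B \<inter> dual_group)" if "B \<in> sets borel" for B
    using that by (simp add: \<mu>_def emeasure_distr[OF idm] space_dual[OF sets_\<nu>])
  have "\<exists>B. B \<in> sets borel \<and> A = dual_group \<inter> B"
    using A unfolding sets_\<nu> by (auto simp: sets_restrict_space)
  moreover have dgb: "dual_group \<in> sets (borel :: ('g \<Rightarrow> complex) measure)"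
    using closed_dual_group by (rule borel_closed)
  ultimately have Ab: "A \<in> sets borel" and AD: "A \<subseteq> dual_group" by auto
  have fin: "emeasure \<mu> (space \<mu>) \<noteq> \<infinity>"
    using em[of UNIV] by (simp add: \<mu>_def)
  have sb: "sets \<mu> = sets borel" by (simp add: \<mu>_def)
  interpret \<mu>: finite_measure \<mu> using fin by (rule finite_measureI)
  \<comment> \<open>A gap of e^2/4 on either side of A leaves U - K with mass below e^2/2, hence a
    norm of at most e / sqrt 2, which is strictly below e.\<close>
  have e2: "0 < e\<^sup>2 / 4" using e by simp
  have fA: "emeasure \<mu> A \<noteq> \<infinity>" by simp
  have "\<exists>K\<in>{K. K \<subseteq> A \<and> compact K}. emeasure \<mu> A < emeasure \<mu> K + ennreal (e\<^sup>2 / 4)"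
    by (rule SUP_approx_ennreal[OF e2 _ inner_regular[OF sb fin Ab] fA]) (auto intro: exI[of _ "{}"])
  then obtain K where K: "K \<subseteq> A" "compact K" "emeasure \<mu> A < emeasure \<mu> K + ennreal (e\<^sup>2 / 4)"
    by auto
  obtain U where U: "A \<subseteq> U" "open U" "emeasure \<mu> U < emeasure \<mu> A + ennreal (e\<^sup>2 / 4)"
    using INF_approx_ennreal[OF e2 outer_regular[OF sb fin Ab] fA] by auto
  have KU: "measure \<mu> (U - K) < e\<^sup>2 / 2"
  proof -
    have Kb: "K \<in> sets \<mu>" and Ub: "U \<in> sets \<mu>"
      using K(2) U(2) by (auto simp: sb compact_imp_closed)
    have lt: "x < y + e\<^sup>2 / 4" if "ennreal x < ennreal y + ennreal (e\<^sup>2 / 4)" "0 \<le> x" "0 \<le> y" for x y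
    proof -
      have "ennreal (y + e\<^sup>2 / 4) = ennreal y + ennreal (e\<^sup>2 / 4)"
        using that by (intro ennreal_plus) auto
      then show ?thesis using that by (metis ennreal_less_iff)
    qed
    have "measure \<mu> A < measure \<mu> K + e\<^sup>2 / 4"
      using K(3) by (intro lt) (simp_all add: \<mu>.emeasure_eq_measure)
    moreover have "measure \<mu> U < measure \<mu> A + e\<^sup>2 / 4"
      using U(3) by (intro lt) (simp_all add: \<mu>.emeasure_eq_measure)
    moreover have "measure \<mu> (U - K) = measure \<mu> U - measure \<mu> K"
      using Kb Ub K(1) U(1) by (intro \<mu>.finite_measure_Diff) auto
    ultimately show ?thesis by simp
  qed
  have "closedin euclidean (- U)" "closedin euclidean K" "disjnt (- U) K"
    using U(1,2) K(1) compact_imp_closed[OF K(2)] by (auto simp: disjnt_def closed_closedin[symmetric])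
  then obtain \<phi> :: "('g \<Rightarrow> complex) \<Rightarrow> real"
    where \<phi>: "continuous_map euclidean (top_of_set {0..1}) \<phi>" "\<phi> ` (- U) \<subseteq> {0}" "\<phi> ` K \<subseteq> {1}"
    using Urysohn_lemma[of euclidean "- U" K 0 1] metrizable_imp_normal_space[OF metrizable_space_euclidean]
    by (metis zero_le_one)
  then have \<phi>c: "continuous_on UNIV \<phi>" and \<phi>01: "0 \<le> \<phi> x" "\<phi> x \<le> 1"
    and \<phi>0: "x \<notin> U \<Longrightarrow> \<phi> x = 0" and \<phi>1: "x \<in> K \<Longrightarrow> \<phi> x = 1" for x
    by (auto simp: continuous_map_in_subtopology Pi_iff)
  have ap: "trig_approx \<nu> (\<lambda>\<xi>. complex_of_real (\<phi> \<xi>))"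
    by (rule trig_approx_continuous[OF \<phi>c])
  have UKb: "U - K \<in> sets borel" using K(2) U(2) by (auto simp: compact_imp_closed)
  have "L2_sq \<nu> (\<lambda>\<xi>. indicator A \<xi> - complex_of_real (\<phi> \<xi>)) \<le> (\<integral>\<^sup>+\<xi>. indicator ((U - K) \<inter> dual_group) \<xi> \<partial>\<nu>)"
    unfolding L2_sq_def
  proof (rule nn_integral_mono)
    fix \<xi> assume "\<xi> \<in> space \<nu>"
    then have "\<xi> \<in> dual_group" by (simp add: space_dual[OF sets_\<nu>])
    moreover have "(cmod (1 - complex_of_real (\<phi> \<xi>)))\<^sup>2 \<le> 1" "(cmod (complex_of_real (\<phi> \<xi>)))\<^sup>2 \<le> 1"
      using \<phi>01[of \<xi>] norm_of_real[of "1 - \<phi> \<xi>", where 'a = complex]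
      by (auto simp: abs_square_le_1)
    ultimately show "ennreal ((cmod (indicator A \<xi> - complex_of_real (\<phi> \<xi>)))\<^sup>2) \<le> indicator ((U - K) \<inter> dual_group) \<xi>"
      using \<phi>1[of \<xi>] \<phi>0[of \<xi>] K(1) U(1) by (auto simp: indicator_def)
  qed
  also have "\<dots> = emeasure \<nu> ((U - K) \<inter> dual_group)"
    using UKb sets_\<nu> dgb by (intro nn_integral_indicator) (auto simp: sets_restrict_space)
  also have "\<dots> = emeasure \<mu> (U - K)" by (rule em[OF UKb, symmetric])
  also have "\<dots> \<le> ennreal (e\<^sup>2 / 2)"
    using KU by (simp add: \<mu>.emeasure_eq_measure)
  also have "e\<^sup>2 / 2 = (e / sqrt 2)\<^sup>2" by (simp add: power_divide)
  finally have "L2_norm \<nu> (\<lambda>\<xi>. indicator A \<xi> - complex_of_real (\<phi> \<xi>)) \<le> e / sqrt 2"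
    using e ap L2A by (intro L2_norm_le L2_diff) (auto simp: trig_approx_def)
  also have "\<dots> < e" using e by (simp add: field_simps)
  finally show "\<exists>g. trig_approx \<nu> g \<and> L2_norm \<nu> (\<lambda>\<xi>. indicator A \<xi> - g \<xi>) < e"
    using ap by blast
qed

lemma trig_approx_simple:
  assumes s: "simple_function \<nu> s"
  shows "trig_approx \<nu> s"
proof -
  have "trig_approx \<nu> (\<lambda>\<xi>. \<Sum>y\<in>s ` space \<nu>. y * indicator (s -` {y} \<inter> space \<nu>) \<xi>)"
    using s by (intro trig_approx_sum trig_approx_scale trig_approx_indicator) (auto dest: simple_functionD)
  moreover have eq: "(\<Sum>y\<in>s ` space \<nu>. y * indicator (s -` {y} \<inter> space \<nu>) \<xi>) = s \<xi>" if "\<xi> \<in> space \<nu>" for \<xi>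
  proof -
    have "s \<xi> = (\<Sum>y\<in>s ` space \<nu>. indicator (s -` {y} \<inter> space \<nu>) \<xi> *\<^sub>R y)"
      by (rule simple_function_indicator_representation_banach[OF s that])
    also have "\<dots> = (\<Sum>y\<in>s ` space \<nu>. y * indicator (s -` {y} \<inter> space \<nu>) \<xi>)"
      by (intro sum.cong) (auto simp: indicator_def)
    finally show ?thesis ..
  qed
  moreover have sm: "s \<in> borel_measurable \<nu>" using s by (rule borel_measurable_simple_function)
  ultimately show ?thesis
    unfolding trig_approx_def
  proof (safe, goal_cases)
    case 1
    show ?case by (rule L2_cong_AE[OF 1(3) sm]) (use eq in auto)
  next
    case (2 e)
    then obtain p where p: "p \<in> trig UNIV"
      "L2_norm \<nu> (\<lambda>\<xi>. (\<Sum>y\<in>s ` space \<nu>. y * indicator (s -` {y} \<inter> space \<nu>) \<xi>) - p \<xi>) < e" by blast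
    moreover have "L2_norm \<nu> (\<lambda>\<xi>. (\<Sum>y\<in>s ` space \<nu>. y * indicator (s -` {y} \<inter> space \<nu>) \<xi>) - p \<xi>)
        = L2_norm \<nu> (\<lambda>\<xi>. s \<xi> - p \<xi>)"
      unfolding L2_norm_def using eq by (intro arg_cong[of _ _ sqrt] Bochner_Integration.integral_cong) auto
    ultimately show ?case by auto
  qed
qed

lemma trig_dense_L2:
  assumes f: "f \<in> L2 \<nu>"
  shows "trig_approx \<nu> f"
proof (rule trig_approxI[OF f])
  note [measurable] = L2_measurable[OF f]
  obtain s where s: "\<And>i. simple_function \<nu> (s i)" and lim: "\<And>\<xi>. \<xi> \<in> space \<nu> \<Longrightarrow> (\<lambda>i. s i \<xi>) \<longlonglongrightarrow> f \<xi>"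
    and le: "\<And>i \<xi>. \<xi> \<in> space \<nu> \<Longrightarrow> cmod (s i \<xi>) \<le> 2 * cmod (f \<xi>)"
    using borel_measurable_implies_sequence_metric[OF L2_measurable[OF f], of 0] by simp metis
  have [measurable]: "s i \<in> borel_measurable \<nu>" for i using s by (rule borel_measurable_simple_function)
  fix e :: real assume e: "0 < e"
  have "(\<lambda>i. \<integral>\<xi>. (cmod (f \<xi> - s i \<xi>))\<^sup>2 \<partial>\<nu>) \<longlonglongrightarrow> (\<integral>\<xi>. 0 \<partial>\<nu>)"
  \<comment> \<open>The approximants satisfy |s i| <= 2 |f|, so |f - s i| <= 3 |f|; squaring gives
    the factor 9.\<close>
  proof (rule integral_dominated_convergence[where w = "\<lambda>\<xi>. 9 * (cmod (f \<xi>))\<^sup>2"])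
    show "integrable \<nu> (\<lambda>\<xi>. 9 * (cmod (f \<xi>))\<^sup>2)" using f by (simp add: L2_def)
    show "AE \<xi> in \<nu>. (\<lambda>i. (cmod (f \<xi> - s i \<xi>))\<^sup>2) \<longlonglongrightarrow> 0"
    proof (rule AE_I2)
      fix \<xi> assume "\<xi> \<in> space \<nu>"
      from tendsto_power[OF tendsto_norm[OF tendsto_diff[OF tendsto_const lim[OF this]]], of "f \<xi>" 2]
      show "(\<lambda>i. (cmod (f \<xi> - s i \<xi>))\<^sup>2) \<longlonglongrightarrow> 0" by simp
    qed
    show "AE \<xi> in \<nu>. norm ((cmod (f \<xi> - s i \<xi>))\<^sup>2) \<le> 9 * (cmod (f \<xi>))\<^sup>2" for i
    proof (rule AE_I2)
      fix \<xi> assume "\<xi> \<in> space \<nu>"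
      then have "cmod (f \<xi> - s i \<xi>) \<le> 3 * cmod (f \<xi>)"
        using le[of \<xi> i] norm_triangle_ineq4[of "f \<xi>" "s i \<xi>"] by simp
      from power_mono[OF this norm_ge_zero, of 2]
      show "norm ((cmod (f \<xi> - s i \<xi>))\<^sup>2) \<le> 9 * (cmod (f \<xi>))\<^sup>2" by (simp add: power_mult_distrib)
    qed
  qed simp_all
  then have "(\<lambda>i. L2_norm \<nu> (\<lambda>\<xi>. f \<xi> - s i \<xi>)) \<longlonglongrightarrow> 0"
    using tendsto_real_sqrt by (fastforce simp: L2_norm_def)
  then have "eventually (\<lambda>i. L2_norm \<nu> (\<lambda>\<xi>. f \<xi> - s i \<xi>) < e) sequentially"
    using e by (rule order_tendstoD(2))
  then obtain i where "L2_norm \<nu> (\<lambda>\<xi>. f \<xi> - s i \<xi>) < e"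
    by (auto simp: eventually_sequentially)
  then show "\<exists>g. trig_approx \<nu> g \<and> L2_norm \<nu> (\<lambda>\<xi>. f \<xi> - g \<xi>) < e"
    using trig_approx_simple[OF s] by blast
qed

end

section \<open>The Zak transform\<close>

text \<open>Expanding the square produces integrals of \<xi> (s - t), which vanish off the diagonal.
  The extended-real form lets the identity act inside a double integral, with coefficients that
  depend on the point of C.\<close>

lemma nn_integral_trig_parseval:
  assumes m: "dual_haar m" and A: "finite A"
  shows "(\<integral>\<^sup>+\<xi>. ennreal ((cmod (\<Sum>t\<in>A. c t * \<xi> (- t)))\<^sup>2) \<partial>m) = (\<Sum>t\<in>A. ennreal ((cmod (c t))\<^sup>2))"
proof -
  interpret finite_measure m by (rule dual_haar_finite[OF m])
  note sm = dual_haar_sets[OF m]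
  note [measurable] = measurable_coord[OF sm]
  have prob: "measure m (space m) = 1"
    using m by (auto simp: dual_haar_def measure_def)
  have b1: "cmod (\<xi> t) = 1" if "\<xi> \<in> space m" for \<xi> t
    using that dual_groupD(2) by (auto simp: space_dual[OF sm])
  have int: "integrable m (\<lambda>\<xi>. \<xi> t)" for t
    by (rule integrable_const_bound[of _ 1]) (auto simp: b1)
  have orth: "(\<integral>\<xi>. \<xi> t \<partial>m) = (if t = 0 then 1 else 0)" for t
  proof (cases "t = 0")
    case True
    have "(\<integral>\<xi>. \<xi> t \<partial>m) = (\<integral>\<xi>. 1 \<partial>m)"
      using True by (intro Bochner_Integration.integral_cong) (auto simp: space_dual[OF sm] dual_group_zero)
    then show ?thesis using True prob by simp
  qed (simp add: integral_character_zero[OF m])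
  have eq: "complex_of_real ((cmod (\<Sum>t\<in>A. c t * \<xi> (- t)))\<^sup>2) = (\<Sum>t\<in>A. \<Sum>s\<in>A. c t * cnj (c s) * \<xi> (s - t))"
    if "\<xi> \<in> space m" for \<xi>
  proof -
    have \<xi>: "\<xi> \<in> dual_group" using that by (simp add: space_dual[OF sm])
    have "\<xi> (- t) * cnj (\<xi> (- s)) = \<xi> (s - t)" for s t
      using dual_group_minus[OF \<xi>, of "- s"] dual_groupD(1)[OF \<xi>, of s "- t"] by (simp add: mult.commute)
    then have *: "c t * \<xi> (- t) * cnj (c s * \<xi> (- s)) = c t * cnj (c s) * \<xi> (s - t)" for s t
      by (metis (no_types, lifting) complex_cnj_mult mult.assoc mult.left_commute)
    then show ?thesis
      unfolding complex_norm_square cnj_sum sum_product by (simp only: *)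
  qed
  have "complex_of_real (\<integral>\<xi>. (cmod (\<Sum>t\<in>A. c t * \<xi> (- t)))\<^sup>2 \<partial>m)
      = (\<integral>\<xi>. complex_of_real ((cmod (\<Sum>t\<in>A. c t * \<xi> (- t)))\<^sup>2) \<partial>m)"
    by (rule integral_complex_of_real[symmetric])
  also have "\<dots> = (\<integral>\<xi>. (\<Sum>t\<in>A. \<Sum>s\<in>A. c t * cnj (c s) * \<xi> (s - t)) \<partial>m)"
    by (intro Bochner_Integration.integral_cong eq) simp
  also have "\<dots> = (\<Sum>t\<in>A. \<Sum>s\<in>A. c t * cnj (c s) * (if s - t = 0 then 1 else 0))"
    by (subst Bochner_Integration.integral_sum, (auto intro!: Bochner_Integration.integrable_sum integrable_mult_right int)[1])+
       (simp only: integral_mult_right_zero orth)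
  also have "\<dots> = (\<Sum>t\<in>A. \<Sum>s\<in>A. if s = t then c t * cnj (c s) else 0)"
    by (intro sum.cong) auto
  also have "\<dots> = (\<Sum>t\<in>A. c t * cnj (c t))"
    using A by simp
  also have "\<dots> = complex_of_real (\<Sum>t\<in>A. (cmod (c t))\<^sup>2)"
    by (simp add: complex_norm_square[symmetric])
  finally have val: "(\<integral>\<xi>. (cmod (\<Sum>t\<in>A. c t * \<xi> (- t)))\<^sup>2 \<partial>m) = (\<Sum>t\<in>A. (cmod (c t))\<^sup>2)"
    by (simp only: of_real_eq_iff)
  have bd: "cmod (\<Sum>t\<in>A. c t * \<xi> (- t)) \<le> (\<Sum>t\<in>A. cmod (c t))" if "\<xi> \<in> space m" for \<xi>
    by (rule order_trans[OF norm_sum]) (simp add: norm_mult b1[OF that])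
  have "integrable m (\<lambda>\<xi>. (cmod (\<Sum>t\<in>A. c t * \<xi> (- t)))\<^sup>2)"
    using bd by (intro integrable_const_bound[of _ "(\<Sum>t\<in>A. cmod (c t))\<^sup>2"]) (auto intro!: power_mono)
  then show ?thesis
    by (subst nn_integral_eq_integral) (auto simp: val sum_ennreal)
qed

locale zak_setting =
  fixes M :: "'x measure"
    and \<sigma> :: "'g::{ab_group_add, countable} \<Rightarrow> 'x \<Rightarrow> 'x"
    and J :: "'g \<Rightarrow> 'x \<Rightarrow> real"
    and C :: "'x set"
    and m :: "('g \<Rightarrow> complex) measure"
  assumes sigma_finite_M: "sigma_finite_measure M"
    and quasi: "quasi_invariant_action M \<sigma> J"
    and tiling: "tiling_set M \<sigma> C"
    and haar: "dual_haar m"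
begin

abbreviation N where "N \<equiv> restrict_space M C"
abbreviation P where "P \<equiv> m \<Otimes>\<^sub>M N"
abbreviation rep where "rep \<equiv> action_rep \<sigma> J"

lemma C_sets [measurable]: "C \<in> sets M"
  using tiling by (simp add: tiling_set_def)

sublocale M: sigma_finite_measure M by (rule sigma_finite_M)
sublocale N: sigma_finite_measure N by (rule sigma_finite_measure_restrict_space[OF sigma_finite_M C_sets])
sublocale m: finite_measure m by (rule dual_haar_finite[OF haar])
sublocale P: pair_sigma_finite m N ..

lemmas sets_m = dual_haar_sets[OF haar]
lemmas space_m = space_dual[OF sets_m]

lemma coord_measurable: "(\<lambda>p. fst p t) \<in> borel_measurable P"
  by (rule measurable_compose[OF measurable_fst measurable_coord[OF sets_m]])

lemma measurable_N: "f \<in> borel_measurable M \<Longrightarrow> f \<in> borel_measurable N"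
  by (rule measurable_restrict_space1)

lemma AE_N: "(AE x in M. Q x) \<Longrightarrow> (AE x in N. Q x)"
  using C_sets by (subst AE_restrict_space_iff) auto

section \<open>The action, its Jacobian and the unitary representation\<close>

lemma action_measurable [measurable]: "\<sigma> g \<in> measurable M M"
  using quasi by (simp add: quasi_invariant_action_def measurable_action_def)

lemma action_add: "x \<in> space M \<Longrightarrow> \<sigma> g (\<sigma> g' x) = \<sigma> (g + g') x"
  using quasi by (simp add: quasi_invariant_action_def measurable_action_def)

lemma action_inv: "x \<in> space M \<Longrightarrow> \<sigma> (- g) (\<sigma> g x) = x" "x \<in> space M \<Longrightarrow> \<sigma> g (\<sigma> (- g) x) = x"
  using quasi by (simp_all add: quasi_invariant_action_def measurable_action_def)

lemma action_space: "x \<in> space M \<Longrightarrow> \<sigma> g x \<in> space M"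
  using measurable_space[OF action_measurable] .

lemma J_measurable [measurable]: "J g \<in> borel_measurable M"
proof -
  have "case_prod J \<in> borel_measurable (count_space UNIV \<Otimes>\<^sub>M M)"
    using quasi by (simp add: quasi_invariant_action_def)
  from measurable_compose[OF measurable_Pair1'[of g] this] show ?thesis by simp
qed

lemma J_pos: "x \<in> space M \<Longrightarrow> 0 < J g x"
  using quasi by (simp add: quasi_invariant_action_def)

lemma emeasure_image: "A \<in> sets M \<Longrightarrow> emeasure M (\<sigma> g ` A) = (\<integral>\<^sup>+x. ennreal (J g x) * indicator A x \<partial>M)"
  using quasi by (simp add: quasi_invariant_action_def)

lemma image_eq_vimage:
  assumes A: "A \<in> sets M"
  shows "\<sigma> g ` A = \<sigma> (- g) -` A \<inter> space M"
proof (intro equalityI subsetI)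
  fix y assume "y \<in> \<sigma> g ` A"
  then show "y \<in> \<sigma> (- g) -` A \<inter> space M"
    using sets.sets_into_space[OF A] by (auto simp: action_inv action_space subset_eq)
next
  fix y assume "y \<in> \<sigma> (- g) -` A \<inter> space M"
  then show "y \<in> \<sigma> g ` A" using action_inv(2)[of y g] by (metis Int_iff image_eqI vimageD)
qed

lemma image_sets: "A \<in> sets M \<Longrightarrow> \<sigma> g ` A \<in> sets M"
  by (simp add: image_eq_vimage measurable_sets[OF action_measurable])

text \<open>Images under \<sigma> g are preimages under its inverse \<sigma> (- g), so the Jacobian
  relation identifies the density of a pushforward; change of variables follows from it.\<close>

lemma distr_action: "distr M M (\<sigma> (- g)) = density M (\<lambda>x. ennreal (J g x))"
proof (rule measure_eqI)
  fix A assume "A \<in> sets (distr M M (\<sigma> (- g)))"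
  then have A: "A \<in> sets M" by simp
  then show "emeasure (distr M M (\<sigma> (- g))) A = emeasure (density M (\<lambda>x. ennreal (J g x))) A"
    by (simp add: emeasure_distr emeasure_density image_eq_vimage[symmetric] emeasure_image)
qed simp

lemma nn_integral_action:
  assumes [measurable]: "u \<in> borel_measurable M"
  shows "(\<integral>\<^sup>+x. ennreal (J g x) * u (\<sigma> g x) \<partial>M) = (\<integral>\<^sup>+x. u x \<partial>M)"
proof -
  have "(\<integral>\<^sup>+x. ennreal (J g x) * u (\<sigma> g x) \<partial>M) = (\<integral>\<^sup>+x. u (\<sigma> g x) \<partial>density M (\<lambda>x. ennreal (J g x)))"
    by (subst nn_integral_density) auto
  also have "\<dots> = (\<integral>\<^sup>+x. u (\<sigma> g x) \<partial>distr M M (\<sigma> (- g)))"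
    by (simp add: distr_action)
  also have "\<dots> = (\<integral>\<^sup>+x. u (\<sigma> g (\<sigma> (- g) x)) \<partial>M)"
    by (subst nn_integral_distr) auto
  also have "\<dots> = (\<integral>\<^sup>+x. u x \<partial>M)"
    by (intro nn_integral_cong) (simp add: action_inv)
  finally show ?thesis .
qed

text \<open>Both sides are densities of the measure sending A to the mass of its image under
  \<sigma> (a + b): once directly, once by moving A first with b and then with a. On a sigma-finite
  space a density is unique, but only almost everywhere.\<close>

lemma jacobian_cocycle: "AE x in M. J (a + b) x = J a (\<sigma> b x) * J b x"
proof -
  have "AE x in M. ennreal (J (a + b) x) = ennreal (J a (\<sigma> b x) * J b x)"
  proof (rule M.density_unique)
    show "density M (\<lambda>x. ennreal (J (a + b) x)) = density M (\<lambda>x. ennreal (J a (\<sigma> b x) * J b x))"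
    proof (rule measure_eqI)
      fix A assume "A \<in> sets (density M (\<lambda>x. ennreal (J (a + b) x)))"
      then have A: "A \<in> sets M" by simp
      have bA: "\<sigma> b ` A \<in> sets M" by (rule image_sets[OF A])
      have "emeasure (density M (\<lambda>x. ennreal (J a (\<sigma> b x) * J b x))) A
          = (\<integral>\<^sup>+x. ennreal (J b x) * (ennreal (J a (\<sigma> b x)) * indicator (\<sigma> b ` A) (\<sigma> b x)) \<partial>M)"
      proof (subst emeasure_density[OF _ A], measurable, rule nn_integral_cong)
        fix x assume x: "x \<in> space M"
        have "indicator (\<sigma> b ` A) (\<sigma> b x) = (indicator A x :: ennreal)"
          using x by (auto simp: image_eq_vimage[OF A] action_inv action_space indicator_def)
        then show "ennreal (J a (\<sigma> b x) * J b x) * indicator A x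
            = ennreal (J b x) * (ennreal (J a (\<sigma> b x)) * indicator (\<sigma> b ` A) (\<sigma> b x))"
          using J_pos[OF x, of b] J_pos[OF action_space[OF x], of a b] by (simp add: ennreal_mult ac_simps)
      qed
      also have "\<dots> = (\<integral>\<^sup>+x. ennreal (J a x) * indicator (\<sigma> b ` A) x \<partial>M)"
        using bA by (intro nn_integral_action) simp
      also have "\<dots> = emeasure M (\<sigma> a ` (\<sigma> b ` A))"
        by (rule emeasure_image[OF bA, symmetric])
      also have "\<sigma> a ` (\<sigma> b ` A) = \<sigma> (a + b) ` A"
        using sets.sets_into_space[OF A] by (auto simp: image_image action_add subset_eq intro!: image_cong)
      also have "emeasure M \<dots> = emeasure (density M (\<lambda>x. ennreal (J (a + b) x))) A"
        using A by (simp add: emeasure_image emeasure_density)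
      finally show "emeasure (density M (\<lambda>x. ennreal (J (a + b) x))) A
          = emeasure (density M (\<lambda>x. ennreal (J a (\<sigma> b x) * J b x))) A" ..
    qed simp
  qed measurable
  with AE_space show ?thesis
  proof eventually_elim
    case (elim x)
    then have "0 \<le> J (a + b) x" "0 \<le> J a (\<sigma> b x) * J b x"
      using J_pos[of x] J_pos[OF action_space[of x]] by (auto intro!: mult_nonneg_nonneg less_imp_le)
    then show ?case using elim by (simp add: ennreal_inj)
  qed
qed

lemma rep_measurable [measurable]:
  assumes [measurable]: "f \<in> borel_measurable M"
  shows "rep g f \<in> borel_measurable M"
  unfolding action_rep_def by measurable

lemma rep_measurable_N: "f \<in> borel_measurable M \<Longrightarrow> rep g f \<in> borel_measurable N"
  by (intro measurable_N rep_measurable)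

lemma rep_sq: "x \<in> space M \<Longrightarrow> ennreal ((cmod (rep g f x))\<^sup>2) = ennreal (J (- g) x) * ennreal ((cmod (f (\<sigma> (- g) x)))\<^sup>2)"
  using J_pos[of x "- g"] by (simp add: action_rep_def norm_mult power_mult_distrib ennreal_mult)

lemma L2_sq_rep:
  assumes [measurable]: "f \<in> borel_measurable M"
  shows "L2_sq M (rep g f) = L2_sq M f"
proof -
  have "L2_sq M (rep g f) = (\<integral>\<^sup>+x. ennreal (J (- g) x) * ennreal ((cmod (f (\<sigma> (- g) x)))\<^sup>2) \<partial>M)"
    unfolding L2_sq_def by (intro nn_integral_cong rep_sq)
  also have "\<dots> = L2_sq M f"
    unfolding L2_sq_def by (rule nn_integral_action) simp
  finally show ?thesis .
qed

lemma L2_rep: "f \<in> L2 M \<Longrightarrow> rep g f \<in> L2 M"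
  by (simp add: L2_iff L2_sq_rep rep_measurable)

text \<open>The cocycle identity enters at - t and - s, since \<sigma> (- t) is applied after
  \<sigma> (- s); its exceptional null set is inherited.\<close>

lemma rep_rep: "AE x in M. rep s (rep t f) x = rep (s + t) f x"
  using AE_space jacobian_cocycle[of "- t" "- s"]
proof eventually_elim
  case (elim x)
  have eq: "- t + - s = - (s + t)" by simp
  have "J (- (s + t)) x = J (- t) (\<sigma> (- s) x) * J (- s) x"
    and "\<sigma> (- t) (\<sigma> (- s) x) = \<sigma> (- (s + t)) x"
    using elim action_add[of x "- t" "- s"] unfolding eq by blast+
  then have "sqrt (J (- (s + t)) x) = sqrt (J (- t) (\<sigma> (- s) x)) * sqrt (J (- s) x)"
    and "\<sigma> (- t) (\<sigma> (- s) x) = \<sigma> (- (s + t)) x"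
    by (simp_all add: real_sqrt_mult)
  then show ?case by (simp add: action_rep_def mult.commute)
qed

section \<open>Splitting the norm over the tiles\<close>

lemma L2_sq_rep_N:
  assumes [measurable]: "f \<in> borel_measurable M"
  shows "L2_sq N (rep g f) = (\<integral>\<^sup>+x. ennreal ((cmod (f x))\<^sup>2) * indicator (\<sigma> (- g) ` C) x \<partial>M)"
proof -
  have "L2_sq N (rep g f) = (\<integral>\<^sup>+x. ennreal ((cmod (rep g f x))\<^sup>2) * indicator C x \<partial>M)"
    unfolding L2_sq_def by (subst nn_integral_restrict_space) auto
  also have "\<dots> = (\<integral>\<^sup>+x. ennreal (J (- g) x) * (ennreal ((cmod (f (\<sigma> (- g) x)))\<^sup>2) * indicator (\<sigma> (- g) ` C) (\<sigma> (- g) x)) \<partial>M)"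
  proof (intro nn_integral_cong)
    fix x assume x: "x \<in> space M"
    have "indicator (\<sigma> (- g) ` C) (\<sigma> (- g) x) = (indicator C x :: ennreal)"
      using x by (auto simp: image_eq_vimage[OF C_sets] action_inv action_space indicator_def)
    then show "ennreal ((cmod (rep g f x))\<^sup>2) * indicator C x
      = ennreal (J (- g) x) * (ennreal ((cmod (f (\<sigma> (- g) x)))\<^sup>2) * indicator (\<sigma> (- g) ` C) (\<sigma> (- g) x))"
      by (simp add: rep_sq[OF x] mult.assoc)
  qed
  also have "\<dots> = (\<integral>\<^sup>+x. ennreal ((cmod (f x))\<^sup>2) * indicator (\<sigma> (- g) ` C) x \<partial>M)"
    using image_sets[OF C_sets, of "- g"] by (intro nn_integral_action) simp
  finally show ?thesis .
qed

lemma tiling_unique: "AE x in M. \<exists>g. \<forall>g'. x \<in> \<sigma> (- g') ` C \<longleftrightarrow> g' = g"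
proof -
  have "AE x in M. x \<in> (\<Union>g. \<sigma> g ` C)"
    using tiling by (intro AE_I'[of "space M - (\<Union>g. \<sigma> g ` C)"]) (auto simp: tiling_set_def)
  moreover have "AE x in M. \<forall>g g'. g \<noteq> g' \<longrightarrow> x \<notin> \<sigma> g ` C \<inter> \<sigma> g' ` C"
    unfolding AE_all_countable
  proof (intro allI)
    fix g g'
    have "AE x in M. x \<notin> \<sigma> g ` C \<inter> \<sigma> g' ` C" if "g \<noteq> g'"
      using tiling that by (intro AE_not_in) (simp add: tiling_set_def)
    then show "AE x in M. g \<noteq> g' \<longrightarrow> x \<notin> \<sigma> g ` C \<inter> \<sigma> g' ` C"
      by (cases "g = g'") simp_all
  qed
  ultimately show ?thesis
  proof eventually_elim
    case (elim x)
    then obtain g where g: "x \<in> \<sigma> g ` C" by blast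
    have "x \<in> \<sigma> (- g') ` C \<longleftrightarrow> g' = - g" for g'
    proof
      assume "x \<in> \<sigma> (- g') ` C"
      then have "- g' = g" using elim(2) g by (metis Int_iff)
      then show "g' = - g" by auto
    qed (use g in simp)
    then show ?case by blast
  qed
qed

text \<open>Writing the sum over the group as an integral for counting measure permits the exchange
  with integration over M; at almost every point exactly one tile contributes.\<close>

lemma nn_integral_rep_N:
  assumes [measurable]: "f \<in> borel_measurable M"
  shows "(\<integral>\<^sup>+g. L2_sq N (rep g f) \<partial>count_space UNIV) = L2_sq M f"
proof -
  note [measurable] = image_sets[OF C_sets]
  have "(\<integral>\<^sup>+g. L2_sq N (rep g f) \<partial>count_space UNIV)
      = (\<integral>\<^sup>+x. (\<integral>\<^sup>+g. ennreal ((cmod (f x))\<^sup>2) * indicator (\<sigma> (- g) ` C) x \<partial>count_space UNIV) \<partial>M)"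
    unfolding L2_sq_rep_N[OF assms]
    by (rule nn_integral_count_space_nn_integral[symmetric]) (auto intro: countableI_type)
  also have "\<dots> = L2_sq M f"
    unfolding L2_sq_def
  proof (rule nn_integral_cong_AE, use tiling_unique in eventually_elim)
    case (elim x)
    then obtain g0 where g0: "x \<in> \<sigma> (- g') ` C \<longleftrightarrow> g' = g0" for g' by blast
    have "(\<integral>\<^sup>+g. ennreal ((cmod (f x))\<^sup>2) * indicator (\<sigma> (- g) ` C) x \<partial>count_space UNIV)
        = (\<integral>\<^sup>+g. ennreal ((cmod (f x))\<^sup>2) * indicator {g0} g \<partial>count_space UNIV)"
      by (intro nn_integral_cong) (auto simp: indicator_def g0)
    also have "\<dots> = ennreal ((cmod (f x))\<^sup>2)"
      by (simp add: nn_integral_cmult)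
    finally show ?case .
  qed
  finally show ?thesis .
qed

lemma L2_rep_N:
  assumes f: "f \<in> L2 M"
  shows "rep g f \<in> L2 N"
proof -
  have "L2_sq N (rep g f) \<le> L2_sq M f"
    unfolding L2_sq_rep_N[OF L2_measurable[OF f]]
    unfolding L2_sq_def by (intro nn_integral_mono) (auto simp: indicator_def)
  then show ?thesis
    using f by (auto simp: L2_iff intro: rep_measurable_N le_less_trans)
qed

text \<open>The real version of the decomposition, stated as convergence along
  \<open>finite_subsets_at_top\<close>, the filter used by \<open>has_zak\<close>.\<close>

lemma rep_has_sum:
  assumes f: "f \<in> L2 M"
  shows "((\<lambda>g. (L2_norm N (rep g f))\<^sup>2) has_sum (L2_norm M f)\<^sup>2) UNIV"
proof -
  let ?b = "\<lambda>g. (L2_norm N (rep g f))\<^sup>2"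
  have nn: "(\<integral>\<^sup>+g. ennreal (?b g) \<partial>count_space UNIV) = ennreal ((L2_norm M f)\<^sup>2)"
    using nn_integral_rep_N[OF L2_measurable[OF f]] by (simp add: L2_sq_eq L2_rep_N f)
  have int: "integrable (count_space UNIV) ?b"
    by (rule integrableI_bounded) (simp_all add: nn)
  then have abs: "Infinite_Set_Sum.abs_summable_on ?b UNIV" by (simp add: Infinite_Set_Sum.abs_summable_on_def)
  have "infsetsum ?b UNIV = (L2_norm M f)\<^sup>2"
    unfolding infsetsum_def by (subst integral_eq_nn_integral) (auto simp: nn)
  then have "infsum ?b UNIV = (L2_norm M f)\<^sup>2"
    using infsetsum_infsum[OF abs] by simp
  moreover have "?b summable_on UNIV"
    using abs abs_summable_summable abs_summable_equivalent by blast
  ultimately show ?thesis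
    using has_sum_infsum by metis
qed

section \<open>Finite Zak sums as functions on the product space\<close>

definition zsum :: "('x \<Rightarrow> complex) \<Rightarrow> 'g set \<Rightarrow> ('g \<Rightarrow> complex) \<times> 'x \<Rightarrow> complex"
  where "zsum f A = (\<lambda>(\<xi>, x). \<Sum>\<tau>\<in>A. rep \<tau> f x * \<xi> (- \<tau>))"

lemma zsum_measurable:
  assumes f: "f \<in> borel_measurable M"
  shows "zsum f A \<in> borel_measurable P"
proof -
  note [measurable] = rep_measurable_N[OF f]
  note [measurable] = coord_measurable
  show ?thesis unfolding zsum_def case_prod_beta by measurable
qed

text \<open>With x fixed, the sum is a trigonometric polynomial in \<xi> with coefficients
  \<open>rep \<tau> f x\<close>; integrating over the dual first makes Parseval applicable.\<close>

lemma L2_sq_zsum: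
  assumes f: "f \<in> borel_measurable M" and A: "finite A"
  shows "L2_sq P (zsum f A) = (\<Sum>\<tau>\<in>A. L2_sq N (rep \<tau> f))"
proof -
  note [measurable] = rep_measurable_N[OF f] zsum_measurable[OF f]
  have "L2_sq P (zsum f A) = (\<integral>\<^sup>+x. (\<integral>\<^sup>+\<xi>. ennreal ((cmod (zsum f A (\<xi>, x)))\<^sup>2) \<partial>m) \<partial>N)"
    unfolding L2_sq_def by (rule P.nn_integral_snd[symmetric]) simp
  also have "\<dots> = (\<integral>\<^sup>+x. (\<Sum>\<tau>\<in>A. ennreal ((cmod (rep \<tau> f x))\<^sup>2)) \<partial>N)"
    unfolding zsum_def by (simp add: nn_integral_trig_parseval[OF haar A])
  also have "\<dots> = (\<Sum>\<tau>\<in>A. L2_sq N (rep \<tau> f))"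
    unfolding L2_sq_def by (rule nn_integral_sum) simp
  finally show ?thesis .
qed

lemma zsum_L2:
  assumes f: "f \<in> L2 M" and A: "finite A"
  shows "zsum f A \<in> L2 P"
  using L2_sq_zsum[OF L2_measurable[OF f] A] zsum_measurable[OF L2_measurable[OF f]]
  by (simp add: L2_iff L2_sq_eq[OF L2_rep_N[OF f]])

lemma L2_norm_zsum:
  assumes f: "f \<in> L2 M" and A: "finite A"
  shows "(L2_norm P (zsum f A))\<^sup>2 = (\<Sum>\<tau>\<in>A. (L2_norm N (rep \<tau> f))\<^sup>2)"
proof -
  have "ennreal ((L2_norm P (zsum f A))\<^sup>2) = ennreal (\<Sum>\<tau>\<in>A. (L2_norm N (rep \<tau> f))\<^sup>2)"
    using L2_sq_zsum[OF L2_measurable[OF f] A]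
    by (simp add: L2_sq_eq zsum_L2 L2_rep_N f A sum_ennreal)
  then show ?thesis by (subst (asm) ennreal_inj) (auto intro: sum_nonneg)
qed

lemma zsum_diff:
  assumes "finite A" "B \<subseteq> A"
  shows "zsum f A p - zsum f B p = zsum f (A - B) p"
  unfolding zsum_def using assms by (auto simp: sum_diff split: prod.splits)

text \<open>Tonelli's theorem is the bridge from the vector-valued space to the scalar theory. In
  the converse direction, finiteness of the double integral puts almost every slice in L2.\<close>

lemma L2_L2_iff: "F \<in> L2_L2 m N \<longleftrightarrow> case_prod F \<in> L2 P"
  and L2_L2_norm_eq: "F \<in> L2_L2 m N \<Longrightarrow> L2_L2_norm m N F = L2_norm P (case_prod F)"
proof -
  have fst: "L2_sq P (case_prod F) = (\<integral>\<^sup>+\<xi>. L2_sq N (F \<xi>) \<partial>m)" if "case_prod F \<in> borel_measurable P"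
    using that unfolding L2_sq_def by (subst N.nn_integral_fst[symmetric]) auto
  have eqn: "(\<integral>\<^sup>+\<xi>. L2_sq N (F \<xi>) \<partial>m) = (\<integral>\<^sup>+\<xi>. ennreal ((L2_norm N (F \<xi>))\<^sup>2) \<partial>m)" if "AE \<xi> in m. F \<xi> \<in> L2 N"
    by (rule nn_integral_cong_AE, use that in eventually_elim) (rule L2_sq_eq)
  show iff: "F \<in> L2_L2 m N \<longleftrightarrow> case_prod F \<in> L2 P"
  proof
    assume F: "F \<in> L2_L2 m N"
    then have "(\<integral>\<^sup>+\<xi>. ennreal ((L2_norm N (F \<xi>))\<^sup>2) \<partial>m) < \<infinity>"
      by (auto simp: L2_L2_def integrable_iff_bounded)
    then show "case_prod F \<in> L2 P"
      using F fst eqn by (auto simp: L2_L2_def L2_iff)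
  next
    assume F: "case_prod F \<in> L2 P"
    note [measurable] = L2_measurable[OF F]
    have meas: "F \<xi> \<in> borel_measurable N" if "\<xi> \<in> space m" for \<xi>
      using measurable_compose[OF measurable_Pair1'[OF that] L2_measurable[OF F]] by simp
    have "(\<integral>\<^sup>+\<xi>. L2_sq N (F \<xi>) \<partial>m) < \<infinity>" using F fst by (auto simp: L2_iff)
    moreover have "(\<lambda>\<xi>. L2_sq N (F \<xi>)) \<in> borel_measurable m"
      unfolding L2_sq_def by measurable
    ultimately have "AE \<xi> in m. L2_sq N (F \<xi>) \<noteq> \<infinity>"
      by (intro nn_integral_PInf_AE) auto
    with AE_space have AE: "AE \<xi> in m. F \<xi> \<in> L2 N"
      by eventually_elim (auto simp: L2_iff meas less_top)
    have "(\<lambda>\<xi>. (L2_norm N (F \<xi>))\<^sup>2) \<in> borel_measurable m"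
      unfolding L2_norm_sq by measurable
    then have "integrable m (\<lambda>\<xi>. (L2_norm N (F \<xi>))\<^sup>2)"
      using eqn[OF AE] fst F by (intro integrableI_bounded) (auto simp: L2_iff)
    then show "F \<in> L2_L2 m N" using AE F by (auto simp: L2_L2_def L2_iff)
  qed
  assume F: "F \<in> L2_L2 m N"
  then have FP: "case_prod F \<in> L2 P" using iff by blast
  have "ennreal ((L2_norm P (case_prod F))\<^sup>2) = (\<integral>\<^sup>+\<xi>. ennreal ((L2_norm N (F \<xi>))\<^sup>2) \<partial>m)"
    using fst eqn F L2_sq_eq[OF FP] by (auto simp: L2_L2_def)
  also have "\<dots> = ennreal (\<integral>\<xi>. (L2_norm N (F \<xi>))\<^sup>2 \<partial>m)"
    using F by (intro nn_integral_eq_integral) (auto simp: L2_L2_def)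
  finally have "(L2_norm P (case_prod F))\<^sup>2 = (\<integral>\<xi>. (L2_norm N (F \<xi>))\<^sup>2 \<partial>m)"
    by (subst (asm) ennreal_inj) auto
  then show "L2_L2_norm m N F = L2_norm P (case_prod F)"
    unfolding L2_L2_norm_def by (metis L2_norm_nonneg real_sqrt_unique)
qed

text \<open>Describes every representative of the Zak transform, uncurried. The choice made by
  \<open>zak\<close> is not stable under linear combinations or translations as a function, whereas
  this relation is.\<close>

definition is_zak :: "('x \<Rightarrow> complex) \<Rightarrow> (('g \<Rightarrow> complex) \<times> 'x \<Rightarrow> complex) \<Rightarrow> bool"
  where "is_zak f F \<longleftrightarrow> f \<in> L2 M \<and> F \<in> L2 P \<and>
    ((\<lambda>A. L2_norm P (\<lambda>p. F p - zsum f A p)) \<longlongrightarrow> 0) (finite_subsets_at_top UNIV)"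

lemma has_zak_iff:
  assumes f: "f \<in> L2 M"
  shows "has_zak M \<sigma> J C m f F \<longleftrightarrow> is_zak f (case_prod F)"
proof -
  have "L2_L2_norm m N (\<lambda>\<xi> x. F \<xi> x - (\<Sum>\<tau>\<in>A. rep \<tau> f x * \<xi> (- \<tau>)))
      = L2_norm P (\<lambda>p. case_prod F p - zsum f A p)" if A: "finite A" and F: "case_prod F \<in> L2 P" for A
  proof -
    have eq: "case_prod (\<lambda>\<xi> x. F \<xi> x - (\<Sum>\<tau>\<in>A. rep \<tau> f x * \<xi> (- \<tau>))) = (\<lambda>p. case_prod F p - zsum f A p)"
      by (auto simp: zsum_def fun_eq_iff)
    have "(\<lambda>\<xi> x. F \<xi> x - (\<Sum>\<tau>\<in>A. rep \<tau> f x * \<xi> (- \<tau>))) \<in> L2_L2 m N"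
      unfolding L2_L2_iff eq by (intro L2_diff F zsum_L2 f A)
    from L2_L2_norm_eq[OF this] show ?thesis by (simp only: eq)
  qed
  then have "((\<lambda>A. L2_L2_norm m N (\<lambda>\<xi> x. F \<xi> x - (\<Sum>\<tau>\<in>A. rep \<tau> f x * \<xi> (- \<tau>)))) \<longlongrightarrow> 0) (finite_subsets_at_top UNIV)
      \<longleftrightarrow> ((\<lambda>A. L2_norm P (\<lambda>p. case_prod F p - zsum f A p)) \<longlongrightarrow> 0) (finite_subsets_at_top UNIV)"
    if "case_prod F \<in> L2 P"
    using that by (intro tendsto_cong eventually_finite_subsets_at_top_weakI) blast
  then show ?thesis
    unfolding has_zak_def is_zak_def L2_L2_iff using f by blast
qed

text \<open>By Parseval, two nested partial sums differ in squared norm by the part of a convergent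
  positive series lying in the difference of their index sets, so the net of partial sums is
  Cauchy.\<close>

lemma is_zak_exists:
  assumes f: "f \<in> L2 M"
  shows "\<exists>F. is_zak f F"
proof -
  let ?b = "\<lambda>g. (L2_norm N (rep g f))\<^sup>2" and ?B = "(L2_norm M f)\<^sup>2"
  have sums: "(sum ?b \<longlongrightarrow> ?B) (finite_subsets_at_top UNIV)"
    using rep_has_sum[OF f] by (simp add: has_sum_def)
  have le: "sum ?b A \<le> ?B" if "finite A" for A
    using rep_has_sum[OF f] that by (intro finite_sum_le_has_sum[of ?b]) auto
  \<comment> \<open>The tolerance is the square of (1/2)^n, the rate required by
    \<open>L2_complete\<close>.\<close>
  have "\<exists>A. finite A \<and> (\<forall>A'. finite A' \<and> A \<subseteq> A' \<longrightarrow> ?B - (1 / 4) ^ n < sum ?b A')" for n :: nat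
    using order_tendstoD(1)[OF sums, of "?B - (1 / 4) ^ n"] by (auto simp: eventually_finite_subsets_at_top)
  then obtain A where A: "\<And>n. finite (A n)"
    and Alt: "\<And>n A'. finite A' \<Longrightarrow> A n \<subseteq> A' \<Longrightarrow> ?B - (1 / 4) ^ n < sum ?b A'"
    by metis
  \<comment> \<open>Unions make the index sets increasing, so that a difference of partial sums is
    again a partial sum.\<close>
  define D where "D n = (\<Union>k\<le>n. A k)" for n
  have fD: "finite (D n)" for n using A by (simp add: D_def)
  have DS: "D n \<subseteq> D (Suc n)" for n unfolding D_def by (rule UN_mono) auto
  have AD: "A n \<subseteq> D n" for n unfolding D_def by (rule UN_upper) simp
  have close: "L2_norm P (\<lambda>p. zsum f A' p - zsum f (D n) p) \<le> (1 / 2) ^ n" if A': "finite A'" "D n \<subseteq> A'" for n A'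
  proof -
    have "(L2_norm P (\<lambda>p. zsum f A' p - zsum f (D n) p))\<^sup>2 = sum ?b (A' - D n)"
      using A' by (simp add: zsum_diff L2_norm_zsum[OF f])
    also have "\<dots> = sum ?b A' - sum ?b (D n)"
      using A' by (intro sum_diff) auto
    also have "\<dots> \<le> (1 / 4) ^ n"
      using le[OF A'(1)] Alt[OF fD AD, of n] by linarith
    also have "\<dots> = ((1 / 2) ^ n)\<^sup>2"
      by (simp add: power_mult_distrib[symmetric] power2_eq_square)
    finally show ?thesis by (rule power2_le_imp_le) simp
  qed
  obtain F where F: "F \<in> L2 P" and FD: "\<And>n. L2_norm P (\<lambda>p. F p - zsum f (D n) p) \<le> 2 * (1 / 2) ^ n"
    using L2_complete[of "\<lambda>n. zsum f (D n)" P] close[OF fD DS] zsum_L2[OF f fD] by blast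
  have bound: "L2_norm P (\<lambda>p. F p - zsum f A' p) \<le> 3 * (1 / 2) ^ n" if A': "finite A'" "D n \<subseteq> A'" for n A'
  proof -
    have "L2_norm P (\<lambda>p. F p - zsum f A' p)
        \<le> L2_norm P (\<lambda>p. F p - zsum f (D n) p) + L2_norm P (\<lambda>p. zsum f (D n) p - zsum f A' p)"
      by (intro L2_norm_diff_triangle F zsum_L2 f fD A')
    then show ?thesis
      using FD[of n] close[OF A'] L2_norm_minus_commute[of P "zsum f (D n)" "zsum f A'"] by simp
  qed
  have "((\<lambda>A. L2_norm P (\<lambda>p. F p - zsum f A p)) \<longlongrightarrow> 0) (finite_subsets_at_top UNIV)"
  proof (rule tendstoI)
    fix e :: real assume e: "0 < e"
    have "(\<lambda>n. 3 * (1 / 2) ^ n) \<longlonglongrightarrow> (0::real)"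
      by (auto intro!: tendsto_mult_right_zero LIMSEQ_power_zero)
    then obtain n where n: "3 * (1 / 2) ^ n < e"
      using order_tendstoD(2)[OF _ e] by (fastforce simp: eventually_sequentially)
    show "\<forall>\<^sub>F A in finite_subsets_at_top UNIV. dist (L2_norm P (\<lambda>p. F p - zsum f A p)) 0 < e"
      unfolding eventually_finite_subsets_at_top
      using fD[of n] bound[of _ n] n by (intro exI[of _ "D n"]) (auto intro: le_less_trans)
  qed
  then show ?thesis using F f by (auto simp: is_zak_def)
qed

text \<open>The squared norms of the partial sums have two limits: that of F by continuity of the
  norm, and that of f by the decomposition over tiles.\<close>

lemma is_zak_isometry:
  assumes F: "is_zak f F"
  shows "L2_norm P F = L2_norm M f"
proof -
  have f: "f \<in> L2 M" and FL: "F \<in> L2 P"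
    and lim: "((\<lambda>A. L2_norm P (\<lambda>p. F p - zsum f A p)) \<longlongrightarrow> 0) (finite_subsets_at_top UNIV)"
    using F by (auto simp: is_zak_def)
  have "((\<lambda>A. L2_norm P (zsum f A)) \<longlongrightarrow> L2_norm P F) (finite_subsets_at_top UNIV)"
  proof (rule LIM_zero_cancel, rule Lim_null_comparison)
    show "\<forall>\<^sub>F A in finite_subsets_at_top UNIV.
        norm (L2_norm P (zsum f A) - L2_norm P F) \<le> L2_norm P (\<lambda>p. F p - zsum f A p)"
      using L2_norm_triangle_diff[OF FL zsum_L2[OF f]]
      by (intro eventually_finite_subsets_at_top_weakI) (simp add: abs_minus_commute)
  qed (rule lim)
  then have "((\<lambda>A. (L2_norm P (zsum f A))\<^sup>2) \<longlongrightarrow> (L2_norm P F)\<^sup>2) (finite_subsets_at_top UNIV)"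
    by (rule tendsto_power)
  moreover have "((\<lambda>A. (L2_norm P (zsum f A))\<^sup>2) \<longlongrightarrow> (L2_norm M f)\<^sup>2) (finite_subsets_at_top UNIV)"
  proof (rule Lim_transform_eventually)
    show "(sum (\<lambda>g. (L2_norm N (rep g f))\<^sup>2) \<longlongrightarrow> (L2_norm M f)\<^sup>2) (finite_subsets_at_top UNIV)"
      using rep_has_sum[OF f] by (simp add: has_sum_def)
    show "\<forall>\<^sub>F A in finite_subsets_at_top UNIV. (\<Sum>g\<in>A. (L2_norm N (rep g f))\<^sup>2) = (L2_norm P (zsum f A))\<^sup>2"
      by (intro eventually_finite_subsets_at_top_weakI) (simp add: L2_norm_zsum[OF f])
  qed
  ultimately have "(L2_norm P F)\<^sup>2 = (L2_norm M f)\<^sup>2"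
    by (intro tendsto_unique[OF finite_subsets_at_top_neq_bot])
  then show ?thesis by (simp add: power2_eq_iff_nonneg)
qed

lemma zsum_lin: "zsum (\<lambda>x. f x + c * g x) A p = zsum f A p + c * zsum g A p"
  by (cases p) (simp add: zsum_def action_rep_def sum.distrib sum_distrib_left algebra_simps)

lemma is_zak_lin:
  assumes F: "is_zak f F" and G: "is_zak g G"
  shows "is_zak (\<lambda>x. f x + c * g x) (\<lambda>p. F p + c * G p)"
  unfolding is_zak_def
proof (intro conjI)
  have f: "f \<in> L2 M" "g \<in> L2 M" and FL: "F \<in> L2 P" "G \<in> L2 P"
    and limF: "((\<lambda>A. L2_norm P (\<lambda>p. F p - zsum f A p)) \<longlongrightarrow> 0) (finite_subsets_at_top UNIV)"
    and limG: "((\<lambda>A. L2_norm P (\<lambda>p. G p - zsum g A p)) \<longlongrightarrow> 0) (finite_subsets_at_top UNIV)"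
    using F G by (auto simp: is_zak_def)
  show "(\<lambda>x. f x + c * g x) \<in> L2 M" "(\<lambda>p. F p + c * G p) \<in> L2 P"
    using f FL by (auto intro: L2_add L2_scale)
  have "((\<lambda>A. L2_norm P (\<lambda>p. F p - zsum f A p) + cmod c * L2_norm P (\<lambda>p. G p - zsum g A p)) \<longlongrightarrow> 0 + cmod c * 0)
      (finite_subsets_at_top UNIV)"
    by (intro tendsto_intros limF limG)
  then have lim: "((\<lambda>A. L2_norm P (\<lambda>p. F p - zsum f A p) + cmod c * L2_norm P (\<lambda>p. G p - zsum g A p)) \<longlongrightarrow> 0)
      (finite_subsets_at_top UNIV)" by simp
  show "((\<lambda>A. L2_norm P (\<lambda>p. F p + c * G p - zsum (\<lambda>x. f x + c * g x) A p)) \<longlongrightarrow> 0) (finite_subsets_at_top UNIV)"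
  proof (rule tendsto_0_le[OF lim, where K = 1], intro eventually_finite_subsets_at_top_weakI)
    fix A :: "'g set" assume A: "finite A"
    have "L2_norm P (\<lambda>p. F p + c * G p - zsum (\<lambda>x. f x + c * g x) A p)
        = L2_norm P (\<lambda>p. (F p - zsum f A p) + c * (G p - zsum g A p))"
      by (simp add: zsum_lin algebra_simps)
    also have "\<dots> \<le> L2_norm P (\<lambda>p. F p - zsum f A p) + L2_norm P (\<lambda>p. c * (G p - zsum g A p))"
      by (intro L2_norm_triangle L2_diff L2_scale FL zsum_L2 f A)
    finally show "norm (L2_norm P (\<lambda>p. F p + c * G p - zsum (\<lambda>x. f x + c * g x) A p))
        \<le> norm (L2_norm P (\<lambda>p. F p - zsum f A p) + cmod c * L2_norm P (\<lambda>p. G p - zsum g A p)) * 1"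
      by (simp add: L2_norm_scale)
  qed
qed

lemma is_zak_zero: "is_zak (\<lambda>_. 0) (\<lambda>_. 0)"
proof -
  have "zsum (\<lambda>_. 0) A = (\<lambda>_. 0)" for A
    by (auto simp: zsum_def action_rep_def fun_eq_iff)
  then show ?thesis by (simp add: is_zak_def L2_zero L2_norm_def)
qed

lemma AE_P_I:
  assumes "AE x in N. Q x"
  shows "AE p in P. Q (snd p)"
proof -
  obtain X where X: "X \<in> null_sets N" "{x \<in> space N. \<not> Q x} \<subseteq> X"
    using assms by (auto elim: AE_E simp: null_sets_def) 
  have "space m \<times> X \<in> null_sets P"
    using X(1) N.emeasure_pair_measure_Times[of "space m" m X] by (auto simp: null_sets_def)
  then show ?thesis
    by (rule AE_I') (use X(2) in \<open>auto simp: space_pair_measure\<close>)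
qed

lemma AE_space_P: "AE p in P. fst p \<in> dual_group"
  using AE_space by eventually_elim (auto simp: space_pair_measure space_m)

text \<open>Reindexing by \<tau> + \<gamma> and writing \<xi> (- \<tau>) as \<xi> \<gamma> * \<xi>
  (- (\<tau> + \<gamma>)) extracts the factor \<xi> \<gamma>, which has modulus 1 and does not
  affect the error norm.\<close>

lemma is_zak_rep:
  assumes F: "is_zak f F"
  shows "is_zak (rep \<gamma> f) (\<lambda>p. fst p \<gamma> * F p)"
  unfolding is_zak_def
proof (intro conjI)
  have f: "f \<in> L2 M" and FL: "F \<in> L2 P"
    and lim: "((\<lambda>A. L2_norm P (\<lambda>p. F p - zsum f A p)) \<longlongrightarrow> 0) (finite_subsets_at_top UNIV)"
    using F by (auto simp: is_zak_def)
  note [measurable] = L2_measurable[OF f] L2_measurable[OF FL] zsum_measurable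
  show "rep \<gamma> f \<in> L2 M" by (rule L2_rep[OF f])
  note [measurable] = coord_measurable[of \<gamma>]
  have "L2_sq P (\<lambda>p. fst p \<gamma> * F p) = L2_sq P F"
    unfolding L2_sq_def
    by (rule nn_integral_cong_AE, use AE_space_P in eventually_elim) (simp add: norm_mult dual_groupD(2))
  then show "(\<lambda>p. fst p \<gamma> * F p) \<in> L2 P"
    using FL by (simp add: L2_iff)
  have eq: "L2_norm P (\<lambda>p. fst p \<gamma> * F p - zsum (rep \<gamma> f) A p) = L2_norm P (\<lambda>p. F p - zsum f ((\<lambda>\<tau>. \<tau> + \<gamma>) ` A) p)" for A
  proof -
    have "AE x in N. \<forall>\<tau>. rep \<tau> (rep \<gamma> f) x = rep (\<tau> + \<gamma>) f x"
      unfolding AE_all_countable by (intro allI AE_N rep_rep)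
    from AE_P_I[OF this] AE_space_P
    have "AE p in P. (cmod (fst p \<gamma> * F p - zsum (rep \<gamma> f) A p))\<^sup>2 = (cmod (F p - zsum f ((\<lambda>\<tau>. \<tau> + \<gamma>) ` A) p))\<^sup>2"
    proof eventually_elim
      case (elim p)
      obtain \<xi> x where p: "p = (\<xi>, x)" by (cases p)
      have \<xi>: "\<xi> \<in> dual_group" using elim p by simp
      have *: "\<xi> \<gamma> * \<xi> (- \<tau> - \<gamma>) = \<xi> (- \<tau>)" for \<tau>
        using dual_groupD(1)[OF \<xi>, of \<gamma> "- \<tau> - \<gamma>"] by simp
      have "zsum (rep \<gamma> f) A p = (\<Sum>\<tau>\<in>A. rep (\<tau> + \<gamma>) f x * (\<xi> \<gamma> * \<xi> (- (\<tau> + \<gamma>))))"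
        using elim by (simp add: zsum_def p *)
      also have "\<dots> = \<xi> \<gamma> * (\<Sum>\<tau>\<in>A. rep (\<tau> + \<gamma>) f x * \<xi> (- (\<tau> + \<gamma>)))"
        by (simp only: sum_distrib_left mult.left_commute)
      also have "(\<Sum>\<tau>\<in>A. rep (\<tau> + \<gamma>) f x * \<xi> (- (\<tau> + \<gamma>))) = zsum f ((\<lambda>\<tau>. \<tau> + \<gamma>) ` A) p"
        by (simp add: zsum_def p sum.reindex)
      finally have "fst p \<gamma> * F p - zsum (rep \<gamma> f) A p = \<xi> \<gamma> * (F p - zsum f ((\<lambda>\<tau>. \<tau> + \<gamma>) ` A) p)"
        by (simp add: p right_diff_distrib)
      then show ?case by (simp add: norm_mult dual_groupD(2)[OF \<xi>])
    qed
    then show ?thesis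
      unfolding L2_norm_def by (intro arg_cong[of _ _ sqrt] integral_cong_AE) measurable
  qed
  \<comment> \<open>Translation permutes the group, hence preserves the filter of finite index sets;
    unconditional convergence survives the reindexing.\<close>
  have "inj (\<lambda>\<tau>::'g. \<tau> + \<gamma>)" "surj (\<lambda>\<tau>::'g. \<tau> + \<gamma>)"
    by (auto simp: inj_def surj_def intro: exI[of _ "_ - \<gamma>"])
  then have "filterlim (\<lambda>A. (\<lambda>\<tau>. \<tau> + \<gamma>) ` A) (finite_subsets_at_top UNIV) (finite_subsets_at_top UNIV)"
    unfolding filterlim_def by (subst filtermap_image_finite_subsets_at_top) auto
  from filterlim_compose[OF lim this]
  show "((\<lambda>A. L2_norm P (\<lambda>p. fst p \<gamma> * F p - zsum (rep \<gamma> f) A p)) \<longlongrightarrow> 0) (finite_subsets_at_top UNIV)"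
    by (simp only: eq)
qed

end

section \<open>Multipliers and the annihilator\<close>

text \<open>Pigeonhole: among the multiples of t two must share a coset, and their difference lies
  in \<Gamma>.\<close>

lemma ex_nmul_mem:
  assumes \<Gamma>: "add_subgroup \<Gamma>" and fin: "finite (cosets \<Gamma>)"
  shows "\<exists>k>0. nmul k t \<in> \<Gamma>"
proof -
  let ?r = "{(s, t). s - t \<in> \<Gamma>}"
  have "range (\<lambda>n. ?r `` {nmul n t}) \<subseteq> cosets \<Gamma>"
    unfolding cosets_def by (intro image_subsetI quotientI UNIV_I)
  then have "\<not> inj (\<lambda>n. ?r `` {nmul n t})"
    using fin finite_subset infinite_UNIV_nat finite_imageD by blast
  then obtain i j where ij: "i < j" "?r `` {nmul i t} = ?r `` {nmul j t}"
    unfolding inj_def by (metis linorder_neqE_nat)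
  have "nmul i t \<in> ?r `` {nmul i t}" using \<Gamma> by (simp add: add_subgroup_def)
  then have "nmul j t - nmul i t \<in> \<Gamma>" unfolding ij(2) by simp
  moreover have "nmul j t - nmul i t = nmul (j - i) t"
    using ij(1) nmul_add[of "j - i" i t] by simp
  ultimately show ?thesis using ij(1) by (intro exI[of _ "j - i"]) simp
qed

text \<open>A character trivial on \<Gamma> is determined by its values on a finite set of coset
  representatives, and each such value is a root of unity of an order fixed by the
  representative.\<close>

lemma finite_annihilator:
  assumes \<Gamma>: "add_subgroup \<Gamma>" and fin: "finite (cosets \<Gamma>)"
  shows "finite (annihilator \<Gamma>)"
proof -
  define T where "T = (\<lambda>c. SOME t. t \<in> c) ` cosets \<Gamma>"
  have T: "finite T" using fin by (simp add: T_def)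
  have rep: "\<exists>s\<in>T. t - s \<in> \<Gamma>" for t
  proof -
    let ?c = "{(s, t). s - t \<in> \<Gamma>} `` {t}"
    have "t \<in> ?c" using \<Gamma> by (simp add: add_subgroup_def)
    then have "(SOME s. s \<in> ?c) \<in> ?c" by (rule someI)
    moreover have "?c \<in> cosets \<Gamma>" unfolding cosets_def by (intro quotientI UNIV_I)
    ultimately show ?thesis unfolding T_def by (intro bexI[OF _ imageI[of ?c]]) auto
  qed
  obtain k where k: "\<And>t. 0 < k t" "\<And>t. nmul (k t) t \<in> \<Gamma>"
    using ex_nmul_mem[OF \<Gamma> fin] by metis
  have "inj_on (\<lambda>\<eta>. restrict \<eta> T) (annihilator \<Gamma>)"
  proof (rule inj_onI, rule ext)
    fix \<eta> \<zeta> t assume \<eta>: "\<eta> \<in> annihilator \<Gamma>" and \<zeta>: "\<zeta> \<in> annihilator \<Gamma>" and eq: "restrict \<eta> T = restrict \<zeta> T"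
    obtain s where s: "s \<in> T" "t - s \<in> \<Gamma>" using rep by blast
    have val: "\<rho> t = \<rho> s" if "\<rho> \<in> annihilator \<Gamma>" for \<rho>
      using dual_groupD(1)[OF annihilator_dual[OF that], of "t - s" s] that s(2) by (simp add: annihilator_def)
    show "\<eta> t = \<zeta> t"
      using val[OF \<eta>] val[OF \<zeta>] fun_cong[OF eq, of s] s(1) by simp
  qed
  moreover have "(\<lambda>\<eta>. restrict \<eta> T) ` annihilator \<Gamma> \<subseteq> Pi\<^sub>E T (\<lambda>t. {z. z ^ k t = 1})"
  proof
    fix \<zeta> assume "\<zeta> \<in> (\<lambda>\<eta>. restrict \<eta> T) ` annihilator \<Gamma>"
    then obtain \<eta> where \<eta>: "\<eta> \<in> annihilator \<Gamma>" "\<zeta> = restrict \<eta> T" by blast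
    have "\<eta> t ^ k t = 1" for t
      using dual_group_nmul[OF annihilator_dual[OF \<eta>(1)], of "k t" t] \<eta>(1) k(2)[of t] by (simp add: annihilator_def)
    then show "\<zeta> \<in> Pi\<^sub>E T (\<lambda>t. {z. z ^ k t = 1})" using \<eta>(2) by auto
  qed
  moreover have "finite (Pi\<^sub>E T (\<lambda>t. {z::complex. z ^ k t = 1}))"
    using T k(1) by (intro finite_PiE finite_nth_roots) auto
  ultimately show ?thesis using finite_subset finite_imageD by blast
qed

lemma one_annihilator: "(\<lambda>_. 1) \<in> annihilator \<Gamma>"
  by (simp add: annihilator_def dual_group_def)

text \<open>Adding an element \<eta>0 with \<eta>0 t different from 1 permutes the annihilator but
  multiplies the sum by \<eta>0 t.\<close>

lemma sum_annihilator:
  assumes \<Gamma>: "add_subgroup \<Gamma>" and t: "t \<notin> \<Gamma>"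
  shows "(\<Sum>\<eta>\<in>annihilator \<Gamma>. \<eta> t) = 0"
proof -
  obtain \<eta>0 where \<eta>0: "\<eta>0 \<in> annihilator \<Gamma>" "\<eta>0 t \<noteq> 1"
    using annihilator_separates[OF \<Gamma> t] by blast
  note d = annihilator_dual[OF \<eta>0(1)]
  have "bij_betw (dual_add \<eta>0) (annihilator \<Gamma>) (annihilator \<Gamma>)"
  proof (rule bij_betwI)
    show "dual_add \<eta>0 \<in> annihilator \<Gamma> \<rightarrow> annihilator \<Gamma>"
      using \<eta>0(1) by (auto simp: annihilator_def intro: dual_add_closed) (simp add: dual_add_def)
    show "dual_add (\<lambda>t. cnj (\<eta>0 t)) \<in> annihilator \<Gamma> \<rightarrow> annihilator \<Gamma>"
      using \<eta>0(1) by (auto simp: annihilator_def intro: dual_add_closed dual_cnj_closed) (simp add: dual_add_def)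
  qed (rule dual_add_cnj[OF d])+
  then have "(\<Sum>\<eta>\<in>annihilator \<Gamma>. dual_add \<eta>0 \<eta> t) = (\<Sum>\<eta>\<in>annihilator \<Gamma>. \<eta> t)"
    by (rule sum.reindex_bij_betw)
  then have "\<eta>0 t * (\<Sum>\<eta>\<in>annihilator \<Gamma>. \<eta> t) = (\<Sum>\<eta>\<in>annihilator \<Gamma>. \<eta> t)"
    by (simp add: dual_add_def sum_distrib_left)
  then show ?thesis using \<eta>0(2) by simp
qed

text \<open>Averaging multiplies the coefficient at t by the mean of \<eta> t over the annihilator,
  which is 1 for t in \<Gamma> and 0 otherwise.\<close>

lemma trig_average:
  assumes \<Gamma>: "add_subgroup \<Gamma>" and fin: "finite (annihilator \<Gamma>)" and p: "p \<in> trig UNIV"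
  shows "\<exists>q\<in>trig \<Gamma>. \<forall>\<xi>. q \<xi> = (\<Sum>\<eta>\<in>annihilator \<Gamma>. p (dual_add \<eta> \<xi>)) / of_nat (card (annihilator \<Gamma>))"
  using p
proof (induction p rule: trig.induct)
  case zero
  then show ?case by (intro bexI[OF _ trig.zero]) simp
next
  case (step p t c)
  then obtain q where q: "q \<in> trig \<Gamma>"
    "\<forall>\<xi>. q \<xi> = (\<Sum>\<eta>\<in>annihilator \<Gamma>. p (dual_add \<eta> \<xi>)) / of_nat (card (annihilator \<Gamma>))" by blast
  have N: "of_nat (card (annihilator \<Gamma>)) \<noteq> (0::complex)"
    using fin one_annihilator[of \<Gamma>] by auto
  have eq: "(\<Sum>\<eta>\<in>annihilator \<Gamma>. p (dual_add \<eta> \<xi>) + c * dual_add \<eta> \<xi> t) / of_nat (card (annihilator \<Gamma>))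
      = q \<xi> + c * \<xi> t * (\<Sum>\<eta>\<in>annihilator \<Gamma>. \<eta> t) / of_nat (card (annihilator \<Gamma>))" for \<xi>
    by (simp add: q sum.distrib add_divide_distrib dual_add_def sum_distrib_left ac_simps)
  show ?case
  proof (cases "t \<in> \<Gamma>")
    case True
    then have "(\<Sum>\<eta>\<in>annihilator \<Gamma>. \<eta> t) = of_nat (card (annihilator \<Gamma>))"
      by (simp add: annihilator_def)
    then show ?thesis
      using N by (intro bexI[OF _ trig.step[OF q(1) True, of c]]) (simp add: eq)
  next
    case False
    then show ?thesis
      by (intro bexI[OF _ q(1)]) (simp add: eq sum_annihilator[OF \<Gamma>])
  qed
qed

section \<open>Multipliers of the Zak transform and the closed span\<close>

context zak_setting
begin

text \<open>Substituting the translate of \<xi> by \<eta> cancels the inverse translation inside W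
  and moves it to u.\<close>

lemma nn_integral_dual_add:
  assumes \<eta>: "\<eta> \<in> dual_group" and u: "u \<in> borel_measurable m" and W: "W \<in> borel_measurable m"
  shows "(\<integral>\<^sup>+\<xi>. u \<xi> * W (dual_add (\<lambda>t. cnj (\<eta> t)) \<xi>) \<partial>m) = (\<integral>\<^sup>+\<xi>. u (dual_add \<eta> \<xi>) * W \<xi> \<partial>m)"
proof -
  note [measurable] = u W measurable_dual_add[OF sets_m \<eta>] measurable_dual_add[OF sets_m dual_cnj_closed[OF \<eta>]]
  have "(\<integral>\<^sup>+\<xi>. u \<xi> * W (dual_add (\<lambda>t. cnj (\<eta> t)) \<xi>) \<partial>m)
      = (\<integral>\<^sup>+\<xi>. u \<xi> * W (dual_add (\<lambda>t. cnj (\<eta> t)) \<xi>) \<partial>distr m m (dual_add \<eta>))"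
    by (simp add: distr_dual_add[OF haar \<eta>])
  also have "\<dots> = (\<integral>\<^sup>+\<xi>. u (dual_add \<eta> \<xi>) * W \<xi> \<partial>m)"
    by (subst nn_integral_distr) (auto simp: dual_add_cnj(2)[OF \<eta>])
  finally show ?thesis .
qed

lemma is_zak_zak: "f \<in> L2 M \<Longrightarrow> is_zak f (case_prod (zak M \<sigma> J C m f))"
proof -
  assume f: "f \<in> L2 M"
  obtain F where "is_zak f F" using is_zak_exists[OF f] by blast
  then have "has_zak M \<sigma> J C m f (curry F)" by (simp add: has_zak_iff[OF f])
  then have "has_zak M \<sigma> J C m f (zak M \<sigma> J C m f)" 
    unfolding zak_def by (rule someI[of "has_zak M \<sigma> J C m f"])
  then show ?thesis by (simp add: has_zak_iff[OF f])
qed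

lemma is_zak_diff: "is_zak f F \<Longrightarrow> is_zak g G \<Longrightarrow> is_zak (\<lambda>x. f x - g x) (\<lambda>p. F p - G p)"
  using is_zak_lin[of f F g G "- 1"] by simp

lemma trig_to_span:
  assumes G: "is_zak \<psi> G" and p: "p \<in> trig \<Gamma>"
  shows "\<exists>K c. finite K \<and> K \<subseteq> (\<lambda>\<gamma>. rep \<gamma> \<psi>) ` \<Gamma> \<and> is_zak (\<lambda>x. \<Sum>g\<in>K. c g * g x) (\<lambda>z. p (fst z) * G z)"
  using p
proof (induction p rule: trig.induct)
  case zero
  then show ?case using is_zak_zero by (intro exI[of _ "{}"]) simp
next
  case (step p t c0)
  then obtain K c where K: "finite K" "K \<subseteq> (\<lambda>\<gamma>. rep \<gamma> \<psi>) ` \<Gamma>"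
    and z: "is_zak (\<lambda>x. \<Sum>g\<in>K. c g * g x) (\<lambda>z. p (fst z) * G z)" by blast
  let ?g = "rep t \<psi>"
  \<comment> \<open>Spans are indexed by functions, and different group elements may give the same
    function \<open>rep t \<psi>\<close>; the new coefficient is therefore added to an old one if
    there is one. Outside K the value of c is arbitrary and is replaced by 0.\<close>
  define c' where "c' = c(?g := (if ?g \<in> K then c ?g else 0) + c0)"
  have "(\<Sum>g\<in>insert ?g K. c' g * g x) = (\<Sum>g\<in>K. c g * g x) + c0 * ?g x" for x
  proof -
    have "(\<Sum>g\<in>K - {?g}. c' g * g x) = (\<Sum>g\<in>K - {?g}. c g * g x)"
      by (intro sum.cong) (auto simp: c'_def)
    then have "(\<Sum>g\<in>insert ?g K. c' g * g x) = c' ?g * ?g x + (\<Sum>g\<in>K - {?g}. c g * g x)"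
      using K(1) by (simp add: sum.insert_remove)
    also have "\<dots> = (\<Sum>g\<in>K. c g * g x) + c0 * ?g x"
      using K(1) by (cases "?g \<in> K") (auto simp: c'_def sum.remove[of K ?g] algebra_simps)
    finally show ?thesis .
  qed
  moreover have "is_zak (\<lambda>x. (\<Sum>g\<in>K. c g * g x) + c0 * ?g x) (\<lambda>z. p (fst z) * G z + c0 * (fst z t * G z))"
    by (rule is_zak_lin[OF z is_zak_rep[OF G]])
  ultimately have "is_zak (\<lambda>x. \<Sum>g\<in>insert ?g K. c' g * g x) (\<lambda>z. (p (fst z) + c0 * fst z t) * G z)"
    by (simp add: algebra_simps)
  then show ?case
    using K step(2) by (intro exI[of _ "insert ?g K"] exI[of _ c']) auto
qed

lemma span_to_trig:
  assumes G: "is_zak \<psi> G" and K: "finite K" "K \<subseteq> (\<lambda>\<gamma>. rep \<gamma> \<psi>) ` \<Gamma>"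
  shows "\<exists>p\<in>trig \<Gamma>. is_zak (\<lambda>x. \<Sum>g\<in>K. c g * g x) (\<lambda>z. p (fst z) * G z)"
  using K
proof (induction K rule: finite_induct)
  case empty
  then show ?case using is_zak_zero by (intro bexI[OF _ trig.zero]) simp
next
  case (insert g K)
  then obtain p where p: "p \<in> trig \<Gamma>" "is_zak (\<lambda>x. \<Sum>g\<in>K. c g * g x) (\<lambda>z. p (fst z) * G z)" by auto
  obtain t where t: "t \<in> \<Gamma>" "g = rep t \<psi>" using insert by auto
  have "is_zak (\<lambda>x. (\<Sum>g\<in>K. c g * g x) + c g * g x) (\<lambda>z. p (fst z) * G z + c g * (fst z t * G z))"
    unfolding t(2) by (rule is_zak_lin[OF p(2) is_zak_rep[OF G]])
  then have "is_zak (\<lambda>x. \<Sum>g\<in>insert g K. c g * g x) (\<lambda>z. (p (fst z) + c g * fst z t) * G z)"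
    using insert(1,2) by (simp add: algebra_simps)
  then show ?case by (intro bexI[OF _ trig.step[OF p(1) t(1)]])
qed

lemma span_imp_multiplier:
  assumes f: "f \<in> invariant_span M \<sigma> J \<Gamma> \<psi>"
    and F: "is_zak f F" and G: "is_zak \<psi> G"
  shows "\<exists>h. h \<in> borel_measurable m \<and> dual_periodic \<Gamma> h \<and> (AE \<xi> in m. AE x in N. F (\<xi>, x) = h \<xi> * G (\<xi>, x))"
proof -
  have "\<forall>n. \<exists>p. p \<in> trig \<Gamma> \<and> L2_norm P (\<lambda>z. F z - p (fst z) * G z) < 1 / Suc n \<and> (\<lambda>z. F z - p (fst z) * G z) \<in> L2 P"
  proof
    fix n
    have "0 < 1 / real (Suc n)" by simp
    then obtain K c where K: "finite K" "K \<subseteq> (\<lambda>\<gamma>. rep \<gamma> \<psi>) ` \<Gamma>"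
      and lt: "L2_norm M (\<lambda>x. f x - (\<Sum>g\<in>K. c g * g x)) < 1 / Suc n"
      using f unfolding invariant_span_def L2_closed_span_def by blast
    obtain p where p: "p \<in> trig \<Gamma>" "is_zak (\<lambda>x. \<Sum>g\<in>K. c g * g x) (\<lambda>z. p (fst z) * G z)"
      using span_to_trig[OF G K] by blast
    have z: "is_zak (\<lambda>x. f x - (\<Sum>g\<in>K. c g * g x)) (\<lambda>z. F z - p (fst z) * G z)"
      by (rule is_zak_diff[OF F p(2)])
    show "\<exists>p. p \<in> trig \<Gamma> \<and> L2_norm P (\<lambda>z. F z - p (fst z) * G z) < 1 / Suc n \<and> (\<lambda>z. F z - p (fst z) * G z) \<in> L2 P"
      using is_zak_isometry[OF z] lt z p(1) by (intro exI[of _ p]) (simp add: is_zak_def)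
  qed
  from choice[OF this] obtain p where p: "\<And>n. p n \<in> trig \<Gamma>"
    and lt: "\<And>n. L2_norm P (\<lambda>z. F z - p n (fst z) * G z) < 1 / Suc n"
    and L: "\<And>n. (\<lambda>z. F z - p n (fst z) * G z) \<in> L2 P" by blast
  have "(\<lambda>n. L2_norm P (\<lambda>z. F z - p n (fst z) * G z)) \<longlonglongrightarrow> 0"
    by (rule tendsto_sandwich[OF _ _ tendsto_const LIMSEQ_inverse_real_of_nat])
       (use lt in \<open>auto simp: inverse_eq_divide intro!: always_eventually less_imp_le\<close>)
  from L2_AE_subseq[OF L this] obtain r where
    "AE z in P. (\<lambda>n. F z - p (r n) (fst z) * G z) \<longlonglongrightarrow> 0" by blast
  then have AE: "AE \<xi> in m. AE x in N. (\<lambda>n. F (\<xi>, x) - p (r n) \<xi> * G (\<xi>, x)) \<longlonglongrightarrow> 0"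
    using P.AE_pair by fastforce
  \<comment> \<open>Where the polynomials diverge, \<open>lim\<close> is unspecified but still
    periodic, because the sequences at \<xi> and at its translates coincide. For almost every \<xi>,
    divergence can happen only if G (\<xi>, x) = 0 for almost every x, and then F (\<xi>, x) = 0 for
    almost every x as well.\<close>
  define h where "h \<xi> = lim (\<lambda>n. p (r n) \<xi>)" for \<xi>
  have "h \<in> borel_measurable m"
    unfolding h_def using p by (intro borel_measurable_lim_metric trig_measurable[OF sets_m m.finite_measure_axioms])
  moreover have "dual_periodic \<Gamma> h"
    unfolding dual_periodic_def h_def using trig_periodic[OF p] by simp
  moreover have "AE \<xi> in m. AE x in N. F (\<xi>, x) = h \<xi> * G (\<xi>, x)"
    using AE
  proof eventually_elim
    case (elim \<xi>)
    have conv: "(\<lambda>n. p (r n) \<xi> * G (\<xi>, x)) \<longlonglongrightarrow> F (\<xi>, x)"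
      if "(\<lambda>n. F (\<xi>, x) - p (r n) \<xi> * G (\<xi>, x)) \<longlonglongrightarrow> 0" for x
      using tendsto_diff[OF tendsto_const[of "F (\<xi>, x)"] that] by simp
    have hconv: "(\<lambda>n. p (r n) \<xi>) \<longlonglongrightarrow> h \<xi>"
      if "(\<lambda>n. F (\<xi>, x) - p (r n) \<xi> * G (\<xi>, x)) \<longlonglongrightarrow> 0" "G (\<xi>, x) \<noteq> 0" for x
    proof -
      have "(\<lambda>n. p (r n) \<xi> * G (\<xi>, x) / G (\<xi>, x)) \<longlonglongrightarrow> F (\<xi>, x) / G (\<xi>, x)"
        by (intro tendsto_divide conv that tendsto_const)
      then have "(\<lambda>n. p (r n) \<xi>) \<longlonglongrightarrow> F (\<xi>, x) / G (\<xi>, x)" using that(2) by simp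
      then show ?thesis unfolding h_def by (simp add: limI)
    qed
    show ?case
      using elim
    proof eventually_elim
      case (elim x)
      show ?case
      proof (cases "G (\<xi>, x) = 0")
        case True
        then show ?thesis using conv[OF elim] by (simp add: LIMSEQ_const_iff)
      next
        case False
        have "(\<lambda>n. p (r n) \<xi> * G (\<xi>, x)) \<longlonglongrightarrow> h \<xi> * G (\<xi>, x)"
          by (intro tendsto_mult hconv[OF elim False] tendsto_const)
        then show ?thesis using conv[OF elim] LIMSEQ_unique by blast
      qed
    qed
  qed
  ultimately show ?thesis by blast
qed

lemma multiplier_imp_span:
  assumes \<Gamma>: "add_subgroup \<Gamma>" and fin: "finite (cosets \<Gamma>)" and f: "f \<in> L2 M"
    and F: "is_zak f F" and G: "is_zak \<psi> G"
    and h: "h \<in> borel_measurable m" "dual_periodic \<Gamma> h"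
    and FG: "AE \<xi> in m. AE x in N. F (\<xi>, x) = h \<xi> * G (\<xi>, x)"
  shows "f \<in> invariant_span M \<sigma> J \<Gamma> \<psi>"
  unfolding invariant_span_def L2_closed_span_def
proof (intro CollectI conjI allI impI f)
  fix e :: real assume e: "0 < e"
  let ?A = "annihilator \<Gamma>"
  have finA: "finite ?A" by (rule finite_annihilator[OF \<Gamma> fin])
  have FL: "F \<in> L2 P" and GL: "G \<in> L2 P" using F G by (auto simp: is_zak_def)
  note [measurable] = L2_measurable[OF FL] L2_measurable[OF GL] h(1)
  define W where "W \<xi> = (\<integral>\<^sup>+x. ennreal ((cmod (G (\<xi>, x)))\<^sup>2) \<partial>N)" for \<xi>
  have Wm [measurable]: "W \<in> borel_measurable m" unfolding W_def by measurable
  \<comment> \<open>Since F - q G = (h - q) G almost everywhere, integrating over x first turns the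
    error on the product space into a weighted error on the dual, with the squared norm of the slice
    of G as weight.\<close>
  have key: "L2_sq P (\<lambda>z. F z - q (fst z) * G z) = (\<integral>\<^sup>+\<xi>. ennreal ((cmod (h \<xi> - q \<xi>))\<^sup>2) * W \<xi> \<partial>m)"
    if [measurable]: "q \<in> borel_measurable m" for q
  proof -
    have "L2_sq P (\<lambda>z. F z - q (fst z) * G z) = (\<integral>\<^sup>+\<xi>. \<integral>\<^sup>+x. ennreal ((cmod (F (\<xi>, x) - q \<xi> * G (\<xi>, x)))\<^sup>2) \<partial>N \<partial>m)"
      unfolding L2_sq_def by (subst N.nn_integral_fst[symmetric]) auto
    also have "\<dots> = (\<integral>\<^sup>+\<xi>. ennreal ((cmod (h \<xi> - q \<xi>))\<^sup>2) * W \<xi> \<partial>m)"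
    proof (rule nn_integral_cong_AE, use FG AE_space in eventually_elim)
      case (elim \<xi>)
      have [measurable]: "(\<lambda>x. G (\<xi>, x)) \<in> borel_measurable N"
        using measurable_compose[OF measurable_Pair1'[OF elim(2)] L2_measurable[OF GL]] .
      have "(\<integral>\<^sup>+x. ennreal ((cmod (F (\<xi>, x) - q \<xi> * G (\<xi>, x)))\<^sup>2) \<partial>N)
          = (\<integral>\<^sup>+x. ennreal ((cmod (h \<xi> - q \<xi>))\<^sup>2) * ennreal ((cmod (G (\<xi>, x)))\<^sup>2) \<partial>N)"
      proof (rule nn_integral_cong_AE, use elim(1) in eventually_elim)
        case (elim x)
        then show ?case
          by (simp add: left_diff_distrib[symmetric] norm_mult power_mult_distrib ennreal_mult)
      qed
      then show ?case by (simp add: W_def nn_integral_cmult)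
    qed
    finally show ?thesis .
  qed
  have intW: "(\<integral>\<^sup>+\<xi>. W \<xi> \<partial>m) < \<infinity>"
    using GL unfolding L2_iff L2_sq_def W_def by (subst N.nn_integral_fst) auto
  \<comment> \<open>The zero polynomial in \<open>key\<close> converts square integrability of F
    into weighted square integrability of h.\<close>
  have inthW: "(\<integral>\<^sup>+\<xi>. ennreal ((cmod (h \<xi>))\<^sup>2) * W \<xi> \<partial>m) < \<infinity>"
    using FL key[of "\<lambda>_. 0"] by (simp add: L2_iff)
  have dual: "\<eta> \<in> dual_group" if "\<eta> \<in> ?A" for \<eta> using that by (rule annihilator_dual)
  have hper: "h (dual_add \<eta> \<xi>) = h \<xi>" if "\<eta> \<in> ?A" "\<xi> \<in> space m" for \<eta> \<xi>
    using h(2) that by (simp add: dual_periodic_def space_m dual_add_commute[of \<eta>])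
  note madd = measurable_dual_add[OF sets_m]
  \<comment> \<open>Summing the translates of \<open>W\<close> over the finite annihilator lets a trigonometric polynomial close to
    \<open>h\<close> be replaced by its average over the annihilator.\<close>
  define V where "V \<xi> = (\<Sum>\<eta>\<in>?A. W (dual_add (\<lambda>t. cnj (\<eta> t)) \<xi>))" for \<xi>
  have Wt: "(\<lambda>\<xi>. W (dual_add (\<lambda>t. cnj (\<eta> t)) \<xi>)) \<in> borel_measurable m" if "\<eta> \<in> ?A" for \<eta>
    by (rule measurable_compose[OF madd[OF dual_cnj_closed[OF dual[OF that]]] Wm])
  have Vm [measurable]: "V \<in> borel_measurable m"
    unfolding V_def by (rule borel_measurable_sum[OF Wt])
  \<comment> \<open>Haar invariance shifts the translations from the weight to the integrand. This
    exchange is used for the total mass, for h, and for the final error.\<close>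
  have intV: "(\<integral>\<^sup>+\<xi>. u \<xi> * V \<xi> \<partial>m) = (\<Sum>\<eta>\<in>?A. \<integral>\<^sup>+\<xi>. u (dual_add \<eta> \<xi>) * W \<xi> \<partial>m)"
    if [measurable]: "u \<in> borel_measurable m" for u :: "_ \<Rightarrow> ennreal"
  proof -
    have "(\<integral>\<^sup>+\<xi>. u \<xi> * V \<xi> \<partial>m) = (\<Sum>\<eta>\<in>?A. \<integral>\<^sup>+\<xi>. u \<xi> * W (dual_add (\<lambda>t. cnj (\<eta> t)) \<xi>) \<partial>m)"
      unfolding V_def sum_distrib_left
      by (rule nn_integral_sum) (intro borel_measurable_times_ennreal that Wt)
    also have "\<dots> = (\<Sum>\<eta>\<in>?A. \<integral>\<^sup>+\<xi>. u (dual_add \<eta> \<xi>) * W \<xi> \<partial>m)"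
      by (intro sum.cong refl nn_integral_dual_add dual that Wm)
    finally show ?thesis .
  qed
  define \<nu> where "\<nu> = density m V"
  have sets_\<nu>: "sets \<nu> = sets (restrict_space borel dual_group)"
    by (simp add: \<nu>_def sets_m)
  have L2_sq_\<nu>: "L2_sq \<nu> u = (\<integral>\<^sup>+\<xi>. ennreal ((cmod (u \<xi>))\<^sup>2) * V \<xi> \<partial>m)" if [measurable]: "u \<in> borel_measurable m" for u
    unfolding L2_sq_def \<nu>_def by (subst nn_integral_density) (auto simp: mult.commute)
  have fin_\<nu>: "finite_measure \<nu>"
  proof (rule finite_measureI)
    have "emeasure \<nu> (space \<nu>) = (\<integral>\<^sup>+\<xi>. 1 * V \<xi> \<partial>m)"
      unfolding \<nu>_def by (subst emeasure_density) (auto intro!: nn_integral_cong)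
    also have "\<dots> = (\<Sum>\<eta>\<in>?A. \<integral>\<^sup>+\<xi>. W \<xi> \<partial>m)" by (subst intV) auto
    also have "\<dots> < \<infinity>" using intW by (simp add: ennreal_mult_less_top of_nat_less_top)
    finally show "emeasure \<nu> (space \<nu>) \<noteq> \<infinity>" by simp
  qed
  \<comment> \<open>By periodicity every translate contributes the same finite integral, and there
    are finitely many of them.\<close>
  have hL: "h \<in> L2 \<nu>"
  proof -
    have "L2_sq \<nu> h = (\<Sum>\<eta>\<in>?A. \<integral>\<^sup>+\<xi>. ennreal ((cmod (h (dual_add \<eta> \<xi>)))\<^sup>2) * W \<xi> \<partial>m)"
      unfolding L2_sq_\<nu>[OF h(1)] by (rule intV) measurable
    also have "\<dots> = (\<Sum>\<eta>\<in>?A. \<integral>\<^sup>+\<xi>. ennreal ((cmod (h \<xi>))\<^sup>2) * W \<xi> \<partial>m)"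
      by (intro sum.cong refl nn_integral_cong) (simp add: hper)
    also have "\<dots> < \<infinity>" using inthW by (simp add: ennreal_mult_less_top of_nat_less_top)
    finally show ?thesis by (simp add: L2_iff \<nu>_def)
  qed
  obtain p where p: "p \<in> trig UNIV" "L2_norm \<nu> (\<lambda>\<xi>. h \<xi> - p \<xi>) < e"
    using trig_dense_L2[OF sets_\<nu> fin_\<nu> hL] e unfolding trig_approx_def by blast
  have pm [measurable]: "p \<in> borel_measurable m"
    by (rule trig_measurable[OF sets_m m.finite_measure_axioms p(1)])
  obtain q where q: "q \<in> trig \<Gamma>"
    and qav: "\<And>\<xi>. q \<xi> = (\<Sum>\<eta>\<in>?A. p (dual_add \<eta> \<xi>)) / of_nat (card ?A)"
    using trig_average[OF \<Gamma> finA p(1)] by blast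
  have qm [measurable]: "q \<in> borel_measurable m"
    by (rule trig_measurable[OF sets_m m.finite_measure_axioms q])
  have cA: "0 < card ?A" using finA one_annihilator[of \<Gamma>] by (auto simp: card_gt_0_iff)
  \<comment> \<open>By periodicity of h, h - q is the mean of the translated errors h - p.
    Cauchy-Schwarz bounds its square by the mean of the squares, and the factor 1 / card is then
    discarded.\<close>
  have avg: "(cmod (h \<xi> - q \<xi>))\<^sup>2 \<le> (\<Sum>\<eta>\<in>?A. (cmod (h (dual_add \<eta> \<xi>) - p (dual_add \<eta> \<xi>)))\<^sup>2)"
    if \<xi>: "\<xi> \<in> space m" for \<xi>
  proof -
    let ?d = "\<lambda>\<eta>. h (dual_add \<eta> \<xi>) - p (dual_add \<eta> \<xi>)"
    have "(\<Sum>\<eta>\<in>?A. ?d \<eta>) = of_nat (card ?A) * (h \<xi> - q \<xi>)"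
      using cA hper[OF _ \<xi>] by (simp add: qav sum_subtractf right_diff_distrib)
    then have "of_nat (card ?A) * cmod (h \<xi> - q \<xi>) = cmod (\<Sum>\<eta>\<in>?A. ?d \<eta>)"
      by (simp add: norm_mult)
    also have "\<dots> \<le> (\<Sum>\<eta>\<in>?A. cmod (?d \<eta>))" by (rule norm_sum)
    finally have "(of_nat (card ?A) * cmod (h \<xi> - q \<xi>))\<^sup>2 \<le> (\<Sum>\<eta>\<in>?A. cmod (?d \<eta>))\<^sup>2"
      by (intro power_mono) auto
    also have "\<dots> \<le> (\<Sum>\<eta>\<in>?A. (cmod (?d \<eta>))\<^sup>2) * card ?A"
      by (rule sum_squared_le_sum_of_squares)
    finally have "real (card ?A) * (real (card ?A) * (cmod (h \<xi> - q \<xi>))\<^sup>2) \<le> real (card ?A) * (\<Sum>\<eta>\<in>?A. (cmod (?d \<eta>))\<^sup>2)"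
      by (simp add: power2_eq_square ac_simps)
    then have "real (card ?A) * (cmod (h \<xi> - q \<xi>))\<^sup>2 \<le> (\<Sum>\<eta>\<in>?A. (cmod (?d \<eta>))\<^sup>2)"
      using cA by simp
    moreover have "1 * (cmod (h \<xi> - q \<xi>))\<^sup>2 \<le> real (card ?A) * (cmod (h \<xi> - q \<xi>))\<^sup>2"
      using cA by (intro mult_right_mono) auto
    ultimately show ?thesis by linarith
  qed
  have "L2_sq P (\<lambda>z. F z - q (fst z) * G z) = (\<integral>\<^sup>+\<xi>. ennreal ((cmod (h \<xi> - q \<xi>))\<^sup>2) * W \<xi> \<partial>m)"
    by (rule key[OF qm])
  also have "\<dots> \<le> (\<integral>\<^sup>+\<xi>. (\<Sum>\<eta>\<in>?A. ennreal ((cmod (h (dual_add \<eta> \<xi>) - p (dual_add \<eta> \<xi>)))\<^sup>2) * W \<xi>) \<partial>m)"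
  proof (rule nn_integral_mono)
    fix \<xi> assume "\<xi> \<in> space m"
    then have "ennreal ((cmod (h \<xi> - q \<xi>))\<^sup>2) \<le> (\<Sum>\<eta>\<in>?A. ennreal ((cmod (h (dual_add \<eta> \<xi>) - p (dual_add \<eta> \<xi>)))\<^sup>2))"
      using avg by (subst sum_ennreal) (auto intro!: ennreal_leI)
    then show "ennreal ((cmod (h \<xi> - q \<xi>))\<^sup>2) * W \<xi>
        \<le> (\<Sum>\<eta>\<in>?A. ennreal ((cmod (h (dual_add \<eta> \<xi>) - p (dual_add \<eta> \<xi>)))\<^sup>2) * W \<xi>)"
      unfolding sum_distrib_right[symmetric] by (intro mult_right_mono) auto
  qed
  also have "\<dots> = (\<Sum>\<eta>\<in>?A. \<integral>\<^sup>+\<xi>. ennreal ((cmod (h (dual_add \<eta> \<xi>) - p (dual_add \<eta> \<xi>)))\<^sup>2) * W \<xi> \<partial>m)"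
  proof (rule nn_integral_sum)
    fix \<eta> assume "\<eta> \<in> ?A"
    note [measurable] = madd[OF dual[OF this]]
    show "(\<lambda>\<xi>. ennreal ((cmod (h (dual_add \<eta> \<xi>) - p (dual_add \<eta> \<xi>)))\<^sup>2) * W \<xi>) \<in> borel_measurable m" by measurable
  qed
  \<comment> \<open>\<open>intV\<close> read backwards: the translated errors weighted by W add up
    exactly to the untranslated error weighted by V.\<close>
  also have "\<dots> = L2_sq \<nu> (\<lambda>\<xi>. h \<xi> - p \<xi>)"
    by (subst L2_sq_\<nu>, measurable) (rule intV[symmetric], measurable)
  finally have le: "L2_sq P (\<lambda>z. F z - q (fst z) * G z) \<le> L2_sq \<nu> (\<lambda>\<xi>. h \<xi> - p \<xi>)" .
  obtain K c where K: "finite K" "K \<subseteq> (\<lambda>\<gamma>. rep \<gamma> \<psi>) ` \<Gamma>"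
    and z: "is_zak (\<lambda>x. \<Sum>g\<in>K. c g * g x) (\<lambda>z. q (fst z) * G z)"
    using trig_to_span[OF G q] by blast
  note zd = is_zak_diff[OF F z]
  have "L2_norm M (\<lambda>x. f x - (\<Sum>g\<in>K. c g * g x)) = L2_norm P (\<lambda>z. F z - q (fst z) * G z)"
    by (rule is_zak_isometry[OF zd, symmetric])
  also have "\<dots> \<le> L2_norm \<nu> (\<lambda>\<xi>. h \<xi> - p \<xi>)"
    using le zd L2_sq_eq[OF L2_diff[OF hL trig_L2[OF sets_\<nu> fin_\<nu> p(1)]]]
    by (intro L2_norm_le) (auto simp: is_zak_def)
  also have "\<dots> < e" by (rule p(2))
  finally show "\<exists>K c. finite K \<and> K \<subseteq> (\<lambda>\<gamma>. rep \<gamma> \<psi>) ` \<Gamma> \<and> L2_norm M (\<lambda>x. f x - (\<Sum>g\<in>K. c g * g x)) < e"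
    using K by blast
qed

end

theorem theorem2p7:
  fixes M :: "'x measure"
    and \<sigma> :: "'g::{ab_group_add, countable} \<Rightarrow> 'x \<Rightarrow> 'x"
    and J :: "'g \<Rightarrow> 'x \<Rightarrow> real"
    and \<Gamma> :: "'g set"
    and C :: "'x set"
    and m :: "('g \<Rightarrow> complex) measure"
    and \<psi> :: "'x \<Rightarrow> complex"
  assumes "add_subgroup \<Gamma>"
    and "finite (cosets \<Gamma>)"
    and "sigma_finite_measure M"
    and "quasi_invariant_action M \<sigma> J"
    and "tiling_set M \<sigma> C"
    and "dual_haar m"
    and "\<psi> \<in> L2 M"
  shows "(\<forall>f \<in> invariant_span M \<sigma> J \<Gamma> \<psi>.
            \<exists>h. h \<in> borel_measurable m \<and> dual_periodic \<Gamma> h \<and>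
              (AE \<xi> in m. AE x in restrict_space M C.
                 zak M \<sigma> J C m f \<xi> x = h \<xi> * zak M \<sigma> J C m \<psi> \<xi> x)) \<and>
         (\<forall>f \<in> L2 M. \<forall>h.
            h \<in> borel_measurable m \<and> dual_periodic \<Gamma> h \<and>
              (AE \<xi> in m. AE x in restrict_space M C.
                 zak M \<sigma> J C m f \<xi> x = h \<xi> * zak M \<sigma> J C m \<psi> \<xi> x)
            \<longrightarrow> f \<in> invariant_span M \<sigma> J \<Gamma> \<psi>)"
proof -
  interpret zak_setting M \<sigma> J C m
    using assms(3-6) by (rule zak_setting.intro)
  show ?thesis
  proof (intro conjI ballI allI impI)
    fix f assume f: "f \<in> invariant_span M \<sigma> J \<Gamma> \<psi>"
    then have "f \<in> L2 M" by (simp add: invariant_span_def L2_closed_span_def)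
    from span_imp_multiplier[OF f is_zak_zak[OF this] is_zak_zak[OF assms(7)]]
    show "\<exists>h. h \<in> borel_measurable m \<and> dual_periodic \<Gamma> h \<and>
        (AE \<xi> in m. AE x in N. zak M \<sigma> J C m f \<xi> x = h \<xi> * zak M \<sigma> J C m \<psi> \<xi> x)" by simp
  next
    fix f h assume f: "f \<in> L2 M" and h: "h \<in> borel_measurable m \<and> dual_periodic \<Gamma> h \<and>
        (AE \<xi> in m. AE x in N. zak M \<sigma> J C m f \<xi> x = h \<xi> * zak M \<sigma> J C m \<psi> \<xi> x)"
    then show "f \<in> invariant_span M \<sigma> J \<Gamma> \<psi>"
      by (intro multiplier_imp_span[OF assms(1,2) f is_zak_zak[OF f] is_zak_zak[OF assms(7)], of h]) auto
  qed
qed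

end
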